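(* Let $\Gamma$ be a finite group and $s:\operatorname{Gal}(\mathbb{C}/\mathbb{R})\to\Gamma$ a homomorphism. For every class triple $(G,c,\pi)$ for $s$, \[|\operatorname{Aut}(G,c,\pi)|=|(\ker\pi)^{\operatorname{im}(s)}|\cdot|\operatorname{Aut}_\Gamma(\ker\pi)|.\] Further, for every finite $\Gamma$-module $H$ of order relatively prime to $|\Gamma|$ with $H^\Gamma$ trivial, there is a unique isomorphism class of class triples $(G,c,\pi)$ for $s$ with $\ker\pi$ isomorphic to $H$ as a $\Gamma$-module.
   Context: A class triple for $s$ is a triple $(G,c,\pi)$ where $G$ is a finite group and: (i) $\pi:G\to\Gamma$ is a surjective homomorphism whose kernel is abelian of order coprime to $|\Gamma|$; (ii) $c:\operatorname{Gal}(\mathbb{C}/\mathbb{R})\to G$ is a homomorphism with $\pi\circ c=s$; (iii) $(\ker\pi)^{\Gamma}$ is trivial, where $\Gamma$ acts on $\ker\pi$ by conjugation by preimages in $G$; (iv) $\operatorname{im}c\cap\ker\pi$ is trivial. A morphism $(G_1,c_1,\pi_1)\to(G_2,c_2,\pi_2)$ is a group homomorphism $\tau:G_1\to G_2$ with $\pi_1=\pi_2\circ\tau$ and $\tau\circ c_1=c_2$; $\operatorname{Aut}(G,c,\pi)$ is the group of invertible such endomorphisms. $\ker\pi$ is a $\Gamma$-module via the conjugation action, $\operatorname{Aut}_\Gamma$ denotes $\Gamma$-module automorphisms, and $(\ker\pi)^{\operatorname{im}(s)}$ is the subgroup fixed by $\operatorname{im}(s)\subseteq\Gamma$. *)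

theory Defs
  imports Complex_Main "HOL-Algebra.Group_Action"
begin

definition Gal_CR :: "(complex \<Rightarrow> complex) monoid" where
  "Gal_CR =
     \<lparr>carrier = {\<sigma>. bij \<sigma>
                   \<and> (\<forall>x y. \<sigma> (x + y) = \<sigma> x + \<sigma> y)
                   \<and> (\<forall>x y. \<sigma> (x * y) = \<sigma> x * \<sigma> y)
                   \<and> (\<forall>r::real. \<sigma> (complex_of_real r) = complex_of_real r)},
      mult = (\<circ>),
      one = id\<rparr>"

lemma carrier_Gal_CR: "carrier Gal_CR = {id, cnj}"
proof (intro equalityI subsetI)
  fix \<sigma> assume "\<sigma> \<in> carrier Gal_CR"
  then have add: "\<sigma> (x + y) = \<sigma> x + \<sigma> y" and mul: "\<sigma> (x * y) = \<sigma> x * \<sigma> y"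
    and re: "\<sigma> (complex_of_real r) = complex_of_real r" for x y r
    by (auto simp: Gal_CR_def)
  have "(\<sigma> \<i>)\<^sup>2 = \<i>\<^sup>2"
    using mul[of \<i> \<i>] re[of "-1"] by (simp add: power2_eq_square)
  then have "\<sigma> \<i> = \<i> \<or> \<sigma> \<i> = - \<i>"
    by (simp only: power2_eq_iff)
  moreover have eq: "\<sigma> z = of_real (Re z) + \<sigma> \<i> * of_real (Im z)" for z
    by (metis add complex_eq mul re)
  have "\<sigma> = id" if "\<sigma> \<i> = \<i>"
    by (rule ext, subst eq) (simp add: that complex_eq_iff)
  moreover have "\<sigma> = cnj" if "\<sigma> \<i> = - \<i>"
    by (rule ext, subst eq) (simp add: that complex_eq_iff)
  ultimately show "\<sigma> \<in> {id, cnj}" by blast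
next
  fix \<sigma> assume "\<sigma> \<in> {id, cnj}"
  moreover have "bij cnj" by (rule involuntory_imp_bij) simp
  ultimately show "\<sigma> \<in> carrier Gal_CR" by (auto simp: Gal_CR_def)
qed

lemma group_Gal_CR: "group Gal_CR"
proof (rule groupI)
  have [simp]: "mult Gal_CR = (\<circ>)" "one Gal_CR = id" by (simp_all add: Gal_CR_def)
  have [simp]: "cnj \<circ> cnj = id" by (simp add: fun_eq_iff)
  show "\<exists>y\<in>carrier Gal_CR. y \<otimes>\<^bsub>Gal_CR\<^esub> x = \<one>\<^bsub>Gal_CR\<^esub>" if "x \<in> carrier Gal_CR" for x
    using that by (auto simp: carrier_Gal_CR)
qed (auto simp: Gal_CR_def bij_comp)

text \<open>
  A \<open>\<Gamma>\<close>-module is a (multiplicatively written) abelian group with an action of \<open>\<Gamma>\<close> by group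
  endomorphisms. Following \<open>group_action\<close>, each \<open>\<phi> g\<close> is extensional on the carrier.
\<close>

locale group_module = group_action \<Gamma> "carrier H" \<phi> + comm_group H
  for \<Gamma> :: "'g monoid" and H :: "'h monoid" and \<phi> :: "'g \<Rightarrow> 'h \<Rightarrow> 'h" +
  assumes action_hom: "g \<in> carrier \<Gamma> \<Longrightarrow> \<phi> g \<in> hom H H"

definition fixed_points :: "'g set \<Rightarrow> 'h monoid \<Rightarrow> ('g \<Rightarrow> 'h \<Rightarrow> 'h) \<Rightarrow> 'h set" where
  "fixed_points S H \<phi> = {h \<in> carrier H. \<forall>g\<in>S. \<phi> g h = h}"

definition module_iso ::
  "'g monoid \<Rightarrow> 'a monoid \<Rightarrow> ('g \<Rightarrow> 'a \<Rightarrow> 'a) \<Rightarrow> 'b monoid \<Rightarrow> ('g \<Rightarrow> 'b \<Rightarrow> 'b) \<Rightarrow> ('a \<Rightarrow> 'b) set" where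
  "module_iso \<Gamma> H1 \<phi>1 H2 \<phi>2 =
     {f \<in> iso H1 H2. \<forall>g\<in>carrier \<Gamma>. \<forall>h\<in>carrier H1. f (\<phi>1 g h) = \<phi>2 g (f h)}"

text \<open>Maps are made extensional wherever they are counted.\<close>

definition module_Aut :: "'g monoid \<Rightarrow> 'h monoid \<Rightarrow> ('g \<Rightarrow> 'h \<Rightarrow> 'h) \<Rightarrow> ('h \<Rightarrow> 'h) set" where
  "module_Aut \<Gamma> H \<phi> = module_iso \<Gamma> H \<phi> H \<phi> \<inter> extensional (carrier H)"

definition ker_group :: "'a monoid \<Rightarrow> 'g monoid \<Rightarrow> ('a \<Rightarrow> 'g) \<Rightarrow> 'a monoid" where
  "ker_group G \<Gamma> \<pi> = G\<lparr>carrier := kernel G \<Gamma> \<pi>\<rparr>"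

definition conj_action :: "'a monoid \<Rightarrow> 'g monoid \<Rightarrow> ('a \<Rightarrow> 'g) \<Rightarrow> 'g \<Rightarrow> 'a \<Rightarrow> 'a" where
  "conj_action G \<Gamma> \<pi> g =
     (\<lambda>k\<in>kernel G \<Gamma> \<pi>.
        let x = (SOME x. x \<in> carrier G \<and> \<pi> x = g) in x \<otimes>\<^bsub>G\<^esub> k \<otimes>\<^bsub>G\<^esub> inv\<^bsub>G\<^esub> x)"

type_synonym ('a, 'g) triple = "'a monoid \<times> ((complex \<Rightarrow> complex) \<Rightarrow> 'a) \<times> ('a \<Rightarrow> 'g)"

fun class_triple :: "'g monoid \<Rightarrow> ((complex \<Rightarrow> complex) \<Rightarrow> 'g) \<Rightarrow> ('a, 'g) triple \<Rightarrow> bool" where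
  "class_triple \<Gamma> s (G, c, \<pi>) \<longleftrightarrow>
     group G \<and> finite (carrier G) \<and>
     \<pi> \<in> epi G \<Gamma> \<and> comm_group (ker_group G \<Gamma> \<pi>) \<and> coprime (order (ker_group G \<Gamma> \<pi>)) (order \<Gamma>) \<and>
     c \<in> hom Gal_CR G \<and> (\<forall>\<sigma>\<in>carrier Gal_CR. \<pi> (c \<sigma>) = s \<sigma>) \<and>
     fixed_points (carrier \<Gamma>) (ker_group G \<Gamma> \<pi>) (conj_action G \<Gamma> \<pi>) = {\<one>\<^bsub>G\<^esub>} \<and>
     c ` carrier Gal_CR \<inter> kernel G \<Gamma> \<pi> = {\<one>\<^bsub>G\<^esub>}"

fun triple_hom :: "('a, 'g) triple \<Rightarrow> ('b, 'g) triple \<Rightarrow> ('a \<Rightarrow> 'b) set" where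
  "triple_hom (G1, c1, \<pi>1) (G2, c2, \<pi>2) =
     {\<tau> \<in> hom G1 G2 \<inter> extensional (carrier G1).
        (\<forall>x\<in>carrier G1. \<pi>1 x = \<pi>2 (\<tau> x)) \<and> (\<forall>\<sigma>\<in>carrier Gal_CR. \<tau> (c1 \<sigma>) = c2 \<sigma>)}"

fun triple_iso :: "('a, 'g) triple \<Rightarrow> ('b, 'g) triple \<Rightarrow> ('a \<Rightarrow> 'b) set" where
  "triple_iso (G1, c1, \<pi>1) (G2, c2, \<pi>2) =
     {\<tau> \<in> triple_hom (G1, c1, \<pi>1) (G2, c2, \<pi>2).
        \<exists>\<rho> \<in> triple_hom (G2, c2, \<pi>2) (G1, c1, \<pi>1).
          compose (carrier G1) \<rho> \<tau> = (\<lambda>x\<in>carrier G1. x) \<and>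
          compose (carrier G2) \<tau> \<rho> = (\<lambda>y\<in>carrier G2. y)}"

definition triple_Aut :: "('a, 'g) triple \<Rightarrow> ('a \<Rightarrow> 'a) set" where
  "triple_Aut T = triple_iso T T"

definition triple_isomorphic :: "('a, 'g) triple \<Rightarrow> ('b, 'g) triple \<Rightarrow> bool" where
  "triple_isomorphic T1 T2 \<longleftrightarrow> triple_iso T1 T2 \<noteq> {}"

fun kernel_isomorphic ::
  "'g monoid \<Rightarrow> ('a, 'g) triple \<Rightarrow> 'h monoid \<Rightarrow> ('g \<Rightarrow> 'h \<Rightarrow> 'h) \<Rightarrow> bool" where
  "kernel_isomorphic \<Gamma> (G, c, \<pi>) H \<phi> \<longleftrightarrow>
     module_iso \<Gamma> (ker_group G \<Gamma> \<pi>) (conj_action G \<Gamma> \<pi>) H \<phi> \<noteq> {}"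

text \<open>
  The choice of preimage in \<open>conj_action\<close> is immaterial because the kernel is abelian, and the
  kernel is indeed a \<open>\<Gamma>\<close>-module.
\<close>

lemma conj_action_eq:
  assumes G: "group G" and \<Gamma>: "group \<Gamma>" and \<pi>: "\<pi> \<in> hom G \<Gamma>"
    and comm: "comm_group (ker_group G \<Gamma> \<pi>)"
    and x: "x \<in> carrier G" and k: "k \<in> kernel G \<Gamma> \<pi>"
  shows "conj_action G \<Gamma> \<pi> (\<pi> x) k = x \<otimes>\<^bsub>G\<^esub> k \<otimes>\<^bsub>G\<^esub> inv\<^bsub>G\<^esub> x"
proof -
  interpret group_hom G \<Gamma> \<pi>
    using G \<Gamma> \<pi> by (simp add: group_hom_def group_hom_axioms_def)
  define y where "y = (SOME y. y \<in> carrier G \<and> \<pi> y = \<pi> x)"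
  have "y \<in> carrier G \<and> \<pi> y = \<pi> x"
    unfolding y_def by (rule someI[of _ x]) (simp add: x)
  then have y: "y \<in> carrier G" "\<pi> y = \<pi> x" by auto
  have kG: "k \<in> carrier G" using k by (simp add: kernel_def)
  define n where "n = inv\<^bsub>G\<^esub> x \<otimes>\<^bsub>G\<^esub> y"
  have nG: "n \<in> carrier G" using x y by (simp add: n_def)
  have n: "n \<in> kernel G \<Gamma> \<pi>" using x y by (simp add: n_def kernel_def)
  have nk: "n \<otimes>\<^bsub>G\<^esub> k = k \<otimes>\<^bsub>G\<^esub> n"
    using comm_groupE(4)[OF comm, of n k] n k by (simp add: ker_group_def)
  have yn: "y = x \<otimes>\<^bsub>G\<^esub> n" using x y by (simp add: n_def G.m_assoc[symmetric])
  have "y \<otimes>\<^bsub>G\<^esub> k \<otimes>\<^bsub>G\<^esub> inv\<^bsub>G\<^esub> y = x \<otimes>\<^bsub>G\<^esub> (n \<otimes>\<^bsub>G\<^esub> k) \<otimes>\<^bsub>G\<^esub> (inv\<^bsub>G\<^esub> n \<otimes>\<^bsub>G\<^esub> inv\<^bsub>G\<^esub> x)"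
    using x nG kG by (simp add: yn G.inv_mult_group G.m_assoc)
  also have "\<dots> = x \<otimes>\<^bsub>G\<^esub> k \<otimes>\<^bsub>G\<^esub> inv\<^bsub>G\<^esub> x"
    unfolding nk using x nG kG G.m_assoc[of n "inv\<^bsub>G\<^esub> n" "inv\<^bsub>G\<^esub> x"]
    by (simp add: G.m_assoc)
  finally show ?thesis using k by (simp add: conj_action_def y_def Let_def)
qed

lemma group_module_kernel:
  assumes \<Gamma>: "group \<Gamma>" and T: "class_triple \<Gamma> s (G, c, \<pi>)"
  shows "group_module \<Gamma> (ker_group G \<Gamma> \<pi>) (conj_action G \<Gamma> \<pi>)"
proof -
  have G: "group G" and hom: "\<pi> \<in> hom G \<Gamma>" and surj: "\<pi> ` carrier G = carrier \<Gamma>"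
    and comm: "comm_group (ker_group G \<Gamma> \<pi>)"
    using T by (auto simp: epi_def)
  interpret group_hom G \<Gamma> \<pi>
    using G \<Gamma> hom by (simp add: group_hom_def group_hom_axioms_def)
  let ?K = "kernel G \<Gamma> \<pi>" and ?a = "conj_action G \<Gamma> \<pi>"
  have a: "?a (\<pi> x) k = x \<otimes>\<^bsub>G\<^esub> k \<otimes>\<^bsub>G\<^esub> inv\<^bsub>G\<^esub> x" if "x \<in> carrier G" "k \<in> ?K" for x k
    by (rule conj_action_eq[OF G \<Gamma> hom comm that])
  have carr: "carrier (ker_group G \<Gamma> \<pi>) = ?K" "mult (ker_group G \<Gamma> \<pi>) = mult G"
    by (simp_all add: ker_group_def)
  have KG: "k \<in> carrier G" if "k \<in> ?K" for k using that by (simp add: kernel_def)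
  have aK: "?a (\<pi> x) k \<in> ?K" if "x \<in> carrier G" "k \<in> ?K" for x k
    using that by (simp add: a) (simp add: kernel_def)
  have a_mult: "?a (\<pi> x \<otimes>\<^bsub>\<Gamma>\<^esub> \<pi> y) k = ?a (\<pi> x) (?a (\<pi> y) k)"
    if "x \<in> carrier G" "y \<in> carrier G" "k \<in> ?K" for x y k
    using that a[of "x \<otimes>\<^bsub>G\<^esub> y" k] aK[of y k] KG[of k]
    by (simp add: a G.inv_mult_group G.m_assoc)
  have a_one: "?a \<one>\<^bsub>\<Gamma>\<^esub> k = k" if "k \<in> ?K" for k
    using a[of "\<one>\<^bsub>G\<^esub>" k] KG[of k] that by simp
  have ext: "?a g \<in> extensional ?K" for g by (simp add: conj_action_def)
  have Bij: "?a g \<in> Bij ?K" if "g \<in> carrier \<Gamma>" for g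
  proof -
    obtain x where x: "x \<in> carrier G" "g = \<pi> x" using surj \<open>g \<in> carrier \<Gamma>\<close> by blast
    have 1: "?a (\<pi> (inv\<^bsub>G\<^esub> x)) (?a g k) = k" if "k \<in> ?K" for k
      using a_mult[of "inv\<^bsub>G\<^esub> x" x k] that x a_one by simp
    have 2: "?a g (?a (\<pi> (inv\<^bsub>G\<^esub> x)) k) = k" if "k \<in> ?K" for k
      using a_mult[of x "inv\<^bsub>G\<^esub> x" k] that x a_one by simp
    have "bij_betw (?a g) ?K ?K"
      by (rule bij_betw_byWitness[where f' = "?a (\<pi> (inv\<^bsub>G\<^esub> x))"])
        (use 1 2 aK[of x] aK[of "inv\<^bsub>G\<^esub> x"] x in \<open>auto simp del: hom_inv\<close>)
    then show ?thesis using ext by (simp add: Bij_def)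
  qed
  have "?a (g \<otimes>\<^bsub>\<Gamma>\<^esub> h) = compose ?K (?a g) (?a h)" if "g \<in> carrier \<Gamma>" "h \<in> carrier \<Gamma>" for g h
  proof (rule extensionalityI[OF ext compose_extensional])
    fix k assume "k \<in> ?K"
    moreover obtain x where "x \<in> carrier G" "g = \<pi> x" using surj \<open>g \<in> carrier \<Gamma>\<close> by blast
    moreover obtain y where "y \<in> carrier G" "h = \<pi> y" using surj \<open>h \<in> carrier \<Gamma>\<close> by blast
    ultimately show "?a (g \<otimes>\<^bsub>\<Gamma>\<^esub> h) k = compose ?K (?a g) (?a h) k"
      by (simp add: compose_eq a_mult)
  qed
  then have "?a \<in> hom \<Gamma> (BijGroup ?K)"
    using Bij by (auto simp: hom_def BijGroup_def)
  then have act: "group_action \<Gamma> ?K ?a"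
    using \<Gamma> by (simp add: group_action_def group_hom_def group_hom_axioms_def group_BijGroup)
  have "?a g \<in> hom (ker_group G \<Gamma> \<pi>) (ker_group G \<Gamma> \<pi>)" if "g \<in> carrier \<Gamma>" for g
  proof -
    obtain x where x: "x \<in> carrier G" "g = \<pi> x" using surj \<open>g \<in> carrier \<Gamma>\<close> by blast
    have "?a g (k \<otimes>\<^bsub>G\<^esub> l) = ?a g k \<otimes>\<^bsub>G\<^esub> ?a g l" if "k \<in> ?K" "l \<in> ?K" for k l
    proof -
      have kl: "k \<otimes>\<^bsub>G\<^esub> l \<in> ?K" using that by (simp add: kernel_def)
      have "inv\<^bsub>G\<^esub> x \<otimes>\<^bsub>G\<^esub> (x \<otimes>\<^bsub>G\<^esub> z) = z" if "z \<in> carrier G" for z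
        using x that by (simp add: G.m_assoc[symmetric])
      then show ?thesis
        using a[OF x(1) kl] a[OF x(1) that(1)] a[OF x(1) that(2)] x KG that
        by (simp add: G.m_assoc)
    qed
    then show ?thesis using aK x by (auto simp: hom_def carr)
  qed
  then show ?thesis
    using act comm by (simp add: group_module_def group_module_axioms_def carr)
qed

end

theory Submission
  imports Defs "HOL-Algebra.Multiplicative_Group"
begin

text \<open>
  Since \<open>|\<Gamma>|\<close> is invertible on \<open>K = ker \<pi>\<close>, multiplying a cocycle identity over all elements of
  \<open>\<Gamma>\<close> and extracting a \<open>|\<Gamma>|\<close>-th root shows that 1- and 2-cocycles with values in \<open>K\<close> are
  coboundaries. Hence \<open>\<pi>\<close> has a section \<open>\<iota>\<close>, and a conjugate of it satisfies \<open>\<iota> \<circ> s = c\<close>: if \<open>s\<close> is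
  trivial then so is \<open>c\<close>, and otherwise \<open>|K|\<close> is odd, so that the two lifts of complex conjugation
  are conjugate under \<open>K\<close>.

  With such sections chosen, an isomorphism of triples restricts to a \<open>\<Gamma>\<close>-isomorphism \<open>\<alpha>\<close> of kernels
  and moves the section by a 1-cocycle, that is, by conjugation with some \<open>k\<close> in the kernel of the
  target. This \<open>k\<close> is unique because the \<open>\<Gamma>\<close>-invariants are trivial, and compatibility with \<open>c\<close>
  means that \<open>k\<close> is fixed by \<open>im s\<close>. So isomorphisms of triples correspond bijectively to pairs
  \<open>(k, \<alpha>)\<close>, which gives both the automorphism count and uniqueness; existence is the semidirect
  product.
\<close>

section \<open>Vanishing of cohomology in coprime order\<close>

lemma (in comm_group) finprod_hom:
  assumes f: "f \<in> hom G G" and a: "a \<in> A \<rightarrow> carrier G"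
  shows "f (finprod G a A) = finprod G (\<lambda>x. f (a x)) A"
proof -
  interpret f: group_hom G G f
    using f by (simp add: group_hom_def group_hom_axioms_def is_group)
  show ?thesis using a
  proof (induction A rule: infinite_finite_induct)
    case (insert x A)
    then have "finprod G a (insert x A) = a x \<otimes> finprod G a A"
      by (intro finprod_insert) auto
    moreover have "finprod G (\<lambda>x. f (a x)) (insert x A) = f (a x) \<otimes> finprod G (\<lambda>x. f (a x)) A"
      using insert by (intro finprod_insert) (auto simp: Pi_iff)
    ultimately show ?case using insert by (simp add: Pi_iff)
  \<comment> \<open>Over an infinite index set both products have the default value
    \<open>\<one>\<close>, which \<open>f\<close> preserves.\<close>
  qed (simp_all add: finprod_infinite)
qed

text \<open>An inverse \<open>m\<close> of \<open>n\<close> modulo the group order works, because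
  every element raised to the order is \<open>\<one>\<close>. It serves below to extract
  |\<Gamma>|-th roots and square roots.\<close>

lemma (in group) pow_coprime_order_root:
  assumes "finite (carrier G)" and "coprime (order G) n"
  obtains m :: nat where "\<And>x. x \<in> carrier G \<Longrightarrow> (x [^] n) [^] m = x"
proof (cases "n = 0")
  case True
  \<comment> \<open>\<open>order\<close> is 0 for an infinite group, so this case arises when
    \<open>n\<close> is the order of an infinite \<Gamma>; coprimality to 0 leaves only the trivial
    group.\<close>
  then have "order G = 1" using assms by simp
  then have "carrier G = {\<one>}"
    by (metis card_1_singletonE one_closed order_def singletonD)
  then show ?thesis by (intro that[of 0]) auto
next
  case False
  then obtain m q where mq: "n * m = order G * q + 1"
    using bezout_nat[of n "order G"] assms(2) by (metis coprime_imp_gcd_eq_1 gcd.commute)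
  show ?thesis
  proof (rule that[of m])
    fix x assume x: "x \<in> carrier G"
    then have "(x [^] n) [^] m = (x [^] order G) [^] q \<otimes> x [^] (1::nat)"
      by (simp only: nat_pow_pow mq nat_pow_mult)
    also have "\<dots> = x" using x by (simp add: pow_order_eq_1)
    finally show "(x [^] n) [^] m = x" .
  qed
qed

lemma (in group) bij_betw_translation:
  assumes "g \<in> carrier G"
  shows "bij_betw (\<lambda>h. g \<otimes> h) (carrier G) (carrier G)"
  by (rule bij_betw_byWitness[where f' = "\<lambda>h. inv g \<otimes> h"])
     (use assms in \<open>auto simp: m_assoc[symmetric]\<close>)

context group_module
begin

lemma group_acting: "group \<Gamma>"
  using group_hom by (simp add: group_hom_def)

sublocale \<Gamma>: group \<Gamma>
  by (rule group_acting)

lemma action_closed [simp]: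
  "g \<in> carrier \<Gamma> \<Longrightarrow> h \<in> carrier H \<Longrightarrow> \<phi> g h \<in> carrier H"
  using action_hom by (auto simp: hom_def)

lemma action_mult [simp]:
  "g \<in> carrier \<Gamma> \<Longrightarrow> h \<in> carrier H \<Longrightarrow> k \<in> carrier H \<Longrightarrow>
    \<phi> g (h \<otimes>\<^bsub>H\<^esub> k) = \<phi> g h \<otimes>\<^bsub>H\<^esub> \<phi> g k"
  using action_hom by (auto simp: hom_def)

lemma action_group_hom: "g \<in> carrier \<Gamma> \<Longrightarrow> group_hom H H (\<phi> g)"
  using action_hom by (simp add: group_hom_def group_hom_axioms_def is_group)

lemma action_inv [simp]:
  "g \<in> carrier \<Gamma> \<Longrightarrow> h \<in> carrier H \<Longrightarrow> \<phi> g (inv\<^bsub>H\<^esub> h) = inv\<^bsub>H\<^esub> \<phi> g h"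
  using action_group_hom by (simp add: group_hom.hom_inv)

lemma action_unit [simp]: "g \<in> carrier \<Gamma> \<Longrightarrow> \<phi> g \<one>\<^bsub>H\<^esub> = \<one>\<^bsub>H\<^esub>"
  using action_group_hom by (simp add: group_hom.hom_one)

lemma action_pow:
  "g \<in> carrier \<Gamma> \<Longrightarrow> h \<in> carrier H \<Longrightarrow> \<phi> g (h [^]\<^bsub>H\<^esub> (n::nat)) = \<phi> g h [^]\<^bsub>H\<^esub> n"
  using action_group_hom by (simp add: group_hom.hom_nat_pow)

lemma one_action [simp]: "h \<in> carrier H \<Longrightarrow> \<phi> \<one>\<^bsub>\<Gamma>\<^esub> h = h"
  by (metis id_eq_one restrict_apply')

lemma mult_action:
  "g \<in> carrier \<Gamma> \<Longrightarrow> g' \<in> carrier \<Gamma> \<Longrightarrow> h \<in> carrier H \<Longrightarrow>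
    \<phi> (g \<otimes>\<^bsub>\<Gamma>\<^esub> g') h = \<phi> g (\<phi> g' h)"
  by (simp add: composition_rule)

text \<open>Left multiplication by \<open>g\<close> permutes \<Gamma>. This is the change of
  variable needed when a cocycle identity is multiplied over \<Gamma>.\<close>

lemma finprod_translation:
  assumes g: "g \<in> carrier \<Gamma>" and f: "f \<in> carrier \<Gamma> \<rightarrow> carrier H"
  shows "finprod H (\<lambda>h. f (g \<otimes>\<^bsub>\<Gamma>\<^esub> h)) (carrier \<Gamma>) = finprod H f (carrier \<Gamma>)"
proof -
  have b: "bij_betw (\<lambda>h. g \<otimes>\<^bsub>\<Gamma>\<^esub> h) (carrier \<Gamma>) (carrier \<Gamma>)"
    by (rule \<Gamma>.bij_betw_translation[OF g])
  show ?thesis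
    using finprod_reindex[of f "\<lambda>h. g \<otimes>\<^bsub>\<Gamma>\<^esub> h" "carrier \<Gamma>"] b f
    by (simp add: bij_betw_def)
qed

text \<open>The conclusion writes \<open>z g\<close> as \<open>k\<close> divided by
  \<open>\<phi> g k\<close>. Multiplying the cocycle identity over all \<open>h\<close> shows that
  the product \<open>P\<close> of all values of \<open>z\<close> solves this for the |\<Gamma>|-th
  power of \<open>z g\<close>; a |\<Gamma>|-th root of \<open>P\<close> then solves it for
  \<open>z g\<close>.\<close>

lemma one_cocycle_is_coboundary:
  assumes fin: "finite (carrier H)" and cop: "coprime (order H) (order \<Gamma>)"
    and z: "z \<in> carrier \<Gamma> \<rightarrow> carrier H"
    and cocycle: "\<And>g h. g \<in> carrier \<Gamma> \<Longrightarrow> h \<in> carrier \<Gamma> \<Longrightarrow>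
      z (g \<otimes>\<^bsub>\<Gamma>\<^esub> h) = z g \<otimes>\<^bsub>H\<^esub> \<phi> g (z h)"
  obtains k where "k \<in> carrier H" "\<And>g. g \<in> carrier \<Gamma> \<Longrightarrow> z g \<otimes>\<^bsub>H\<^esub> \<phi> g k = k"
proof -
  define P where "P = finprod H z (carrier \<Gamma>)"
  have P: "P \<in> carrier H" using z by (simp add: P_def)
  have norm: "z g [^]\<^bsub>H\<^esub> order \<Gamma> \<otimes>\<^bsub>H\<^esub> \<phi> g P = P" if g: "g \<in> carrier \<Gamma>" for g
  proof -
    have "P = finprod H (\<lambda>h. z (g \<otimes>\<^bsub>\<Gamma>\<^esub> h)) (carrier \<Gamma>)"
      using g z by (simp add: P_def finprod_translation)
    also have "\<dots> = finprod H (\<lambda>h. z g \<otimes>\<^bsub>H\<^esub> \<phi> g (z h)) (carrier \<Gamma>)"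
      using z g by (intro finprod_cong') (auto simp: cocycle Pi_iff)
    also have "\<dots> = finprod H (\<lambda>h. z g) (carrier \<Gamma>) \<otimes>\<^bsub>H\<^esub> finprod H (\<lambda>h. \<phi> g (z h)) (carrier \<Gamma>)"
      using z g by (intro finprod_multf) (auto simp: Pi_iff)
    also have "\<dots> = z g [^]\<^bsub>H\<^esub> order \<Gamma> \<otimes>\<^bsub>H\<^esub> \<phi> g P"
      using z g by (simp add: P_def finprod_hom[OF action_hom] finprod_const order_def Pi_iff)
    finally show ?thesis by simp
  qed
  obtain m :: nat where m: "\<And>x. x \<in> carrier H \<Longrightarrow> (x [^]\<^bsub>H\<^esub> order \<Gamma>) [^]\<^bsub>H\<^esub> m = x"
    using pow_coprime_order_root[OF fin cop] by blast
  show ?thesis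
  proof (rule that[of "P [^]\<^bsub>H\<^esub> m"])
    fix g assume g: "g \<in> carrier \<Gamma>"
    then have zg: "z g \<in> carrier H" using z by auto
    have "(z g [^]\<^bsub>H\<^esub> order \<Gamma> \<otimes>\<^bsub>H\<^esub> \<phi> g P) [^]\<^bsub>H\<^esub> m = z g \<otimes>\<^bsub>H\<^esub> \<phi> g (P [^]\<^bsub>H\<^esub> m)"
      using g P zg by (simp add: nat_pow_distrib action_pow m)
    then show "z g \<otimes>\<^bsub>H\<^esub> \<phi> g (P [^]\<^bsub>H\<^esub> m) = P [^]\<^bsub>H\<^esub> m" using norm[OF g] by simp
  qed (use P in simp)
qed

text \<open>Multiplying the identity over its last argument \<open>l\<close> makes the |\<Gamma>|-th
  power of \<open>f\<close> a coboundary, that of \<open>F\<close>; extracting roots removes the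
  power. The map \<open>u\<close> is what corrects a set-theoretic section with factor set
  \<open>f\<close> to a homomorphism.\<close>

lemma two_cocycle_is_coboundary:
  assumes fin: "finite (carrier H)" and cop: "coprime (order H) (order \<Gamma>)"
    and f: "\<And>g h. g \<in> carrier \<Gamma> \<Longrightarrow> h \<in> carrier \<Gamma> \<Longrightarrow> f g h \<in> carrier H"
    and cocycle: "\<And>g h l. g \<in> carrier \<Gamma> \<Longrightarrow> h \<in> carrier \<Gamma> \<Longrightarrow> l \<in> carrier \<Gamma> \<Longrightarrow>
      f g h \<otimes>\<^bsub>H\<^esub> f (g \<otimes>\<^bsub>\<Gamma>\<^esub> h) l = \<phi> g (f h l) \<otimes>\<^bsub>H\<^esub> f g (h \<otimes>\<^bsub>\<Gamma>\<^esub> l)"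
  obtains u where "u \<in> carrier \<Gamma> \<rightarrow> carrier H"
    "\<And>g h. g \<in> carrier \<Gamma> \<Longrightarrow> h \<in> carrier \<Gamma> \<Longrightarrow>
      u g \<otimes>\<^bsub>H\<^esub> \<phi> g (u h) \<otimes>\<^bsub>H\<^esub> f g h = u (g \<otimes>\<^bsub>\<Gamma>\<^esub> h)"
proof -
  define F where "F g = finprod H (f g) (carrier \<Gamma>)" for g
  have F: "F g \<in> carrier H" if "g \<in> carrier \<Gamma>" for g
    using f that by (simp add: F_def)
  have norm: "f g h [^]\<^bsub>H\<^esub> order \<Gamma> \<otimes>\<^bsub>H\<^esub> F (g \<otimes>\<^bsub>\<Gamma>\<^esub> h) = \<phi> g (F h) \<otimes>\<^bsub>H\<^esub> F g"
    if g: "g \<in> carrier \<Gamma>" and h: "h \<in> carrier \<Gamma>" for g h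
  proof -
    have "f g h [^]\<^bsub>H\<^esub> order \<Gamma> \<otimes>\<^bsub>H\<^esub> F (g \<otimes>\<^bsub>\<Gamma>\<^esub> h)
        = finprod H (\<lambda>l. f g h) (carrier \<Gamma>) \<otimes>\<^bsub>H\<^esub> finprod H (f (g \<otimes>\<^bsub>\<Gamma>\<^esub> h)) (carrier \<Gamma>)"
      using f g h by (simp add: F_def finprod_const order_def)
    also have "\<dots> = finprod H (\<lambda>l. f g h \<otimes>\<^bsub>H\<^esub> f (g \<otimes>\<^bsub>\<Gamma>\<^esub> h) l) (carrier \<Gamma>)"
      using f g h by (intro finprod_multf[symmetric]) auto
    also have "\<dots> = finprod H (\<lambda>l. \<phi> g (f h l) \<otimes>\<^bsub>H\<^esub> f g (h \<otimes>\<^bsub>\<Gamma>\<^esub> l)) (carrier \<Gamma>)"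
      using f g h by (intro finprod_cong') (auto simp: cocycle)
    also have "\<dots> = finprod H (\<lambda>l. \<phi> g (f h l)) (carrier \<Gamma>)
        \<otimes>\<^bsub>H\<^esub> finprod H (\<lambda>l. f g (h \<otimes>\<^bsub>\<Gamma>\<^esub> l)) (carrier \<Gamma>)"
      using f g h by (intro finprod_multf) auto
    also have "\<dots> = \<phi> g (F h) \<otimes>\<^bsub>H\<^esub> F g"
      using f g h by (simp add: F_def finprod_hom[OF action_hom] finprod_translation Pi_iff)
    finally show ?thesis .
  qed
  obtain m :: nat where m: "\<And>x. x \<in> carrier H \<Longrightarrow> (x [^]\<^bsub>H\<^esub> order \<Gamma>) [^]\<^bsub>H\<^esub> m = x"
    using pow_coprime_order_root[OF fin cop] by blast
  show ?thesis
  \<comment> \<open>The root of \<open>F\<close> has coboundary \<open>f\<close>, whereas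
    \<open>u\<close> has to cancel \<open>f\<close>; hence the inverse.\<close>
  proof (rule that[of "\<lambda>g. inv\<^bsub>H\<^esub> (F g [^]\<^bsub>H\<^esub> m)"])
    fix g h assume g: "g \<in> carrier \<Gamma>" and h: "h \<in> carrier \<Gamma>"
    have "(f g h [^]\<^bsub>H\<^esub> order \<Gamma> \<otimes>\<^bsub>H\<^esub> F (g \<otimes>\<^bsub>\<Gamma>\<^esub> h)) [^]\<^bsub>H\<^esub> m
        = f g h \<otimes>\<^bsub>H\<^esub> F (g \<otimes>\<^bsub>\<Gamma>\<^esub> h) [^]\<^bsub>H\<^esub> m"
      using g h f F by (simp add: nat_pow_distrib m)
    moreover have "(\<phi> g (F h) \<otimes>\<^bsub>H\<^esub> F g) [^]\<^bsub>H\<^esub> m = F g [^]\<^bsub>H\<^esub> m \<otimes>\<^bsub>H\<^esub> \<phi> g (F h [^]\<^bsub>H\<^esub> m)"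
      using g h F by (simp add: nat_pow_distrib action_pow m_comm)
    ultimately have "F g [^]\<^bsub>H\<^esub> m \<otimes>\<^bsub>H\<^esub> \<phi> g (F h [^]\<^bsub>H\<^esub> m) = f g h \<otimes>\<^bsub>H\<^esub> F (g \<otimes>\<^bsub>\<Gamma>\<^esub> h) [^]\<^bsub>H\<^esub> m"
      using norm[OF g h] by simp
    then have "inv\<^bsub>H\<^esub> (F g [^]\<^bsub>H\<^esub> m) \<otimes>\<^bsub>H\<^esub> \<phi> g (inv\<^bsub>H\<^esub> (F h [^]\<^bsub>H\<^esub> m))
        = inv\<^bsub>H\<^esub> (f g h) \<otimes>\<^bsub>H\<^esub> inv\<^bsub>H\<^esub> (F (g \<otimes>\<^bsub>\<Gamma>\<^esub> h) [^]\<^bsub>H\<^esub> m)"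
      using g h f F by (simp add: inv_mult[symmetric])
    then show "inv\<^bsub>H\<^esub> (F g [^]\<^bsub>H\<^esub> m) \<otimes>\<^bsub>H\<^esub> \<phi> g (inv\<^bsub>H\<^esub> (F h [^]\<^bsub>H\<^esub> m)) \<otimes>\<^bsub>H\<^esub> f g h
        = inv\<^bsub>H\<^esub> (F (g \<otimes>\<^bsub>\<Gamma>\<^esub> h) [^]\<^bsub>H\<^esub> m)"
      using g h f F by (simp add: m_comm[of _ "f g h"] m_assoc[symmetric])
  qed (use F in auto)
qed

end

section \<open>Splitting a class triple\<close>

text \<open>In this right-nested form, together with \<open>m_assoc\<close>, the rules cancel
  inverse factors in the interior of products.\<close>

lemma (in group) inv_mult_cancel_left:
  assumes "x \<in> carrier G" "z \<in> carrier G"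
  shows "inv x \<otimes> (x \<otimes> z) = z" and "x \<otimes> (inv x \<otimes> z) = z"
  using assms by (simp_all add: m_assoc[symmetric])

locale class_triple_context =
  fixes \<Gamma> :: "'g monoid" and s :: "(complex \<Rightarrow> complex) \<Rightarrow> 'g"
    and G :: "'a monoid" and c :: "(complex \<Rightarrow> complex) \<Rightarrow> 'a" and \<pi> :: "'a \<Rightarrow> 'g"
  assumes group_base: "group \<Gamma>" and triple: "class_triple \<Gamma> s (G, c, \<pi>)"
begin

abbreviation K :: "'a set" where "K \<equiv> kernel G \<Gamma> \<pi>"
abbreviation act :: "'g \<Rightarrow> 'a \<Rightarrow> 'a" where "act \<equiv> conj_action G \<Gamma> \<pi>"

sublocale \<Gamma>: group \<Gamma> by (rule group_base)
sublocale G: group G using triple by simp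
sublocale M: group_module \<Gamma> "ker_group G \<Gamma> \<pi>" act
  by (rule group_module_kernel[OF group_base triple])

lemma finite_carrier: "finite (carrier G)"
  using triple by simp

lemma proj_group_hom: "group_hom G \<Gamma> \<pi>"
  using triple by (simp add: group_hom_def group_hom_axioms_def group_base epi_def)

lemma proj_closed [simp]: "x \<in> carrier G \<Longrightarrow> \<pi> x \<in> carrier \<Gamma>"
  and proj_mult [simp]: "x \<in> carrier G \<Longrightarrow> y \<in> carrier G \<Longrightarrow> \<pi> (x \<otimes>\<^bsub>G\<^esub> y) = \<pi> x \<otimes>\<^bsub>\<Gamma>\<^esub> \<pi> y"
  and proj_inv [simp]: "x \<in> carrier G \<Longrightarrow> \<pi> (inv\<^bsub>G\<^esub> x) = inv\<^bsub>\<Gamma>\<^esub> (\<pi> x)"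
  and proj_one [simp]: "\<pi> \<one>\<^bsub>G\<^esub> = \<one>\<^bsub>\<Gamma>\<^esub>"
  using proj_group_hom
  by (simp_all add: group_hom.hom_closed group_hom.hom_mult group_hom.hom_inv group_hom.hom_one)

lemma proj_surj: "\<pi> ` carrier G = carrier \<Gamma>"
  using triple by (simp add: epi_def)

lemma in_K: "k \<in> carrier G \<Longrightarrow> \<pi> k = \<one>\<^bsub>\<Gamma>\<^esub> \<Longrightarrow> k \<in> K"
  by (simp add: kernel_def)

lemma K_carrier [simp]: "k \<in> K \<Longrightarrow> k \<in> carrier G"
  and proj_K [simp]: "k \<in> K \<Longrightarrow> \<pi> k = \<one>\<^bsub>\<Gamma>\<^esub>"
  by (simp_all add: kernel_def)

lemma ker_group_simps [simp]:
  "carrier (ker_group G \<Gamma> \<pi>) = K" "mult (ker_group G \<Gamma> \<pi>) = mult G" "one (ker_group G \<Gamma> \<pi>) = one G"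
  by (simp_all add: ker_group_def)

lemma K_closed [simp]:
  "\<one>\<^bsub>G\<^esub> \<in> K" "k \<in> K \<Longrightarrow> l \<in> K \<Longrightarrow> k \<otimes>\<^bsub>G\<^esub> l \<in> K" "k \<in> K \<Longrightarrow> inv\<^bsub>G\<^esub> k \<in> K"
  by (auto intro!: in_K)

lemma inv_ker_group [simp]: "k \<in> K \<Longrightarrow> inv\<^bsub>ker_group G \<Gamma> \<pi>\<^esub> k = inv\<^bsub>G\<^esub> k"
  by (rule M.inv_equality) auto

lemma pow_ker_group [simp]: "k [^]\<^bsub>ker_group G \<Gamma> \<pi>\<^esub> (n::nat) = k [^]\<^bsub>G\<^esub> n"
  by (simp add: nat_pow_def)

lemma K_comm: "k \<in> K \<Longrightarrow> l \<in> K \<Longrightarrow> k \<otimes>\<^bsub>G\<^esub> l = l \<otimes>\<^bsub>G\<^esub> k"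
  using M.m_comm by simp

lemma act_proj: "x \<in> carrier G \<Longrightarrow> k \<in> K \<Longrightarrow> act (\<pi> x) k = x \<otimes>\<^bsub>G\<^esub> k \<otimes>\<^bsub>G\<^esub> inv\<^bsub>G\<^esub> x"
  using triple by (intro conj_action_eq) (auto simp: epi_def group_base)

lemma act_K [simp]: "g \<in> carrier \<Gamma> \<Longrightarrow> k \<in> K \<Longrightarrow> act g k \<in> K"
  using M.action_closed by simp

lemma finite_K: "finite K"
  by (rule finite_subset[OF _ finite_carrier]) auto

lemma coprime_order: "coprime (order (ker_group G \<Gamma> \<pi>)) (order \<Gamma>)"
  using triple by simp

lemma proj_c: "\<sigma> \<in> carrier Gal_CR \<Longrightarrow> \<pi> (c \<sigma>) = s \<sigma>"
  using triple by simp

lemma c_group_hom: "group_hom Gal_CR G c"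
  using triple by (simp add: group_hom_def group_hom_axioms_def group_Gal_CR)

lemma c_closed: "\<sigma> \<in> carrier Gal_CR \<Longrightarrow> c \<sigma> \<in> carrier G"
  using c_group_hom by (simp add: group_hom.hom_closed)

lemma s_closed: "\<sigma> \<in> carrier Gal_CR \<Longrightarrow> s \<sigma> \<in> carrier \<Gamma>"
  using c_closed proj_c proj_closed by metis

lemma cnj_Gal: "cnj \<in> carrier Gal_CR" and id_Gal: "id \<in> carrier Gal_CR"
  by (simp_all add: carrier_Gal_CR)

lemma c_id: "c id = \<one>\<^bsub>G\<^esub>"
  using group_hom.hom_one[OF c_group_hom] by (simp add: Gal_CR_def)

lemma c_cnj_square: "c cnj \<otimes>\<^bsub>G\<^esub> c cnj = \<one>\<^bsub>G\<^esub>"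
proof -
  have "cnj \<circ> cnj = id" by (simp add: fun_eq_iff)
  then show ?thesis
    using group_hom.hom_mult[OF c_group_hom cnj_Gal cnj_Gal] c_id by (simp add: Gal_CR_def)
qed

lemma c_in_K: "\<sigma> \<in> carrier Gal_CR \<Longrightarrow> c \<sigma> \<in> K \<Longrightarrow> c \<sigma> = \<one>\<^bsub>G\<^esub>"
  using triple by auto

lemma fixed_trivial:
  assumes "k \<in> K" "\<And>g. g \<in> carrier \<Gamma> \<Longrightarrow> act g k = k"
  shows "k = \<one>\<^bsub>G\<^esub>"
proof -
  have "k \<in> fixed_points (carrier \<Gamma>) (ker_group G \<Gamma> \<pi>) act"
    using assms by (simp add: fixed_points_def)
  then show ?thesis using triple by simp
qed

text \<open>The case of an abelian kernel of the Schur--Zassenhaus theorem.\<close>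

lemma proj_splits:
  obtains \<iota> where "\<iota> \<in> hom \<Gamma> G" "\<And>g. g \<in> carrier \<Gamma> \<Longrightarrow> \<pi> (\<iota> g) = g"
proof -
  define r where "r = inv_into (carrier G) \<pi>"
  have r: "r g \<in> carrier G" and proj_r: "\<pi> (r g) = g" if "g \<in> carrier \<Gamma>" for g
    using that proj_surj by (simp_all add: r_def inv_into_into f_inv_into_f)
  \<comment> \<open>The factor set of the extension: \<open>r g\<close> times \<open>r h\<close> is
    \<open>f g h\<close> times the value of \<open>r\<close> at the product.\<close>
  define f where "f g h = r g \<otimes>\<^bsub>G\<^esub> r h \<otimes>\<^bsub>G\<^esub> inv\<^bsub>G\<^esub> r (g \<otimes>\<^bsub>\<Gamma>\<^esub> h)" for g h
  have f: "f g h \<in> K" if "g \<in> carrier \<Gamma>" "h \<in> carrier \<Gamma>" for g h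
    unfolding f_def using that r by (intro in_K) (simp_all add: proj_r)
  have act_r: "act g k = r g \<otimes>\<^bsub>G\<^esub> k \<otimes>\<^bsub>G\<^esub> inv\<^bsub>G\<^esub> r g" if "g \<in> carrier \<Gamma>" "k \<in> K" for g k
    using act_proj[of "r g" k] that r proj_r by simp
  \<comment> \<open>After the inner factors cancel, both sides are the product of
    \<open>r g\<close>, \<open>r h\<close>, \<open>r l\<close> and the inverse of \<open>r\<close>
    at the triple product.\<close>
  have cocycle: "f g h \<otimes>\<^bsub>G\<^esub> f (g \<otimes>\<^bsub>\<Gamma>\<^esub> h) l = act g (f h l) \<otimes>\<^bsub>G\<^esub> f g (h \<otimes>\<^bsub>\<Gamma>\<^esub> l)"
    if "g \<in> carrier \<Gamma>" "h \<in> carrier \<Gamma>" "l \<in> carrier \<Gamma>" for g h l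
    using that r by (simp add: act_r f) (simp add: f_def G.m_assoc \<Gamma>.m_assoc G.inv_mult_cancel_left)
  obtain u where u: "u \<in> carrier \<Gamma> \<rightarrow> K"
    and uf: "\<And>g h. g \<in> carrier \<Gamma> \<Longrightarrow> h \<in> carrier \<Gamma> \<Longrightarrow>
      u g \<otimes>\<^bsub>G\<^esub> act g (u h) \<otimes>\<^bsub>G\<^esub> f g h = u (g \<otimes>\<^bsub>\<Gamma>\<^esub> h)"
    using M.two_cocycle_is_coboundary[of f, unfolded ker_group_simps, OF finite_K coprime_order f cocycle]
    by blast
  have uK: "u g \<in> K" if "g \<in> carrier \<Gamma>" for g using u that by auto
  show ?thesis
  \<comment> \<open>Moving \<open>u h\<close> to the left past \<open>r g\<close> turns it into
    \<open>act g (u h)\<close>; the factor set produced by \<open>r g\<close> and \<open>r h\<close>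
    is then absorbed by \<open>uf\<close>.\<close>
  proof (rule that[of "\<lambda>g. u g \<otimes>\<^bsub>G\<^esub> r g"])
    have "u (g \<otimes>\<^bsub>\<Gamma>\<^esub> h) \<otimes>\<^bsub>G\<^esub> r (g \<otimes>\<^bsub>\<Gamma>\<^esub> h) = (u g \<otimes>\<^bsub>G\<^esub> r g) \<otimes>\<^bsub>G\<^esub> (u h \<otimes>\<^bsub>G\<^esub> r h)"
      if "g \<in> carrier \<Gamma>" "h \<in> carrier \<Gamma>" for g h
      using that r uK
      by (simp add: act_r flip: uf) (simp add: f_def G.m_assoc G.inv_mult_cancel_left)
    then show "(\<lambda>g. u g \<otimes>\<^bsub>G\<^esub> r g) \<in> hom \<Gamma> G"
      using r uK by (auto simp: hom_def)
  qed (use r uK proj_r in simp)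
qed

text \<open>Only complex conjugation matters, since \<open>Gal_CR\<close> consists of
  \<open>id\<close> and \<open>cnj\<close>. Conjugating a section \<open>j\<close> by
  \<open>k\<close> in \<open>K\<close> multiplies \<open>j t\<close> on the left by \<open>k\<close>
  divided by \<open>act t k\<close>, so this quotient has to equal \<open>z\<close>, the quotient of
  \<open>C\<close> by \<open>j t\<close>.\<close>

lemma proj_splits_over_c:
  obtains \<iota> where "\<iota> \<in> hom \<Gamma> G" "\<And>g. g \<in> carrier \<Gamma> \<Longrightarrow> \<pi> (\<iota> g) = g"
    "\<And>\<sigma>. \<sigma> \<in> carrier Gal_CR \<Longrightarrow> \<iota> (s \<sigma>) = c \<sigma>"
proof -
  obtain j where j: "j \<in> hom \<Gamma> G" and proj_j: "\<And>g. g \<in> carrier \<Gamma> \<Longrightarrow> \<pi> (j g) = g"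
    using proj_splits by metis
  interpret j: group_hom \<Gamma> G j
    using j by (simp add: group_hom_def group_hom_axioms_def group_base G.is_group)
  define t where "t = s cnj"
  define C where "C = c cnj"
  have t: "t \<in> carrier \<Gamma>" unfolding t_def by (rule s_closed[OF cnj_Gal])
  have C: "C \<in> carrier G" "\<pi> C = t" "C \<otimes>\<^bsub>G\<^esub> C = \<one>\<^bsub>G\<^esub>"
    unfolding C_def t_def by (rule c_closed[OF cnj_Gal] proj_c[OF cnj_Gal] c_cnj_square)+
  have tt: "t \<otimes>\<^bsub>\<Gamma>\<^esub> t = \<one>\<^bsub>\<Gamma>\<^esub>" using proj_mult[OF C(1) C(1)] C(2,3) by simp
  have jt: "j t \<otimes>\<^bsub>G\<^esub> j t = \<one>\<^bsub>G\<^esub>" using j.hom_mult[OF t t] tt by simp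
  obtain k where k: "k \<in> K" and kj: "k \<otimes>\<^bsub>G\<^esub> j t \<otimes>\<^bsub>G\<^esub> inv\<^bsub>G\<^esub> k = C"
  proof (cases "t = \<one>\<^bsub>\<Gamma>\<^esub>")
    case True
    \<comment> \<open>Here \<open>C\<close> lies in \<open>K\<close>, and the image of
      \<open>c\<close> meets \<open>K\<close> only in the unit.\<close>
    then have "C = \<one>\<^bsub>G\<^esub>" using c_in_K[OF cnj_Gal] C in_K by (simp add: C_def)
    then show ?thesis using True by (intro that[of "\<one>\<^bsub>G\<^esub>"]) auto
  next
    case False
    \<comment> \<open>The element \<open>t\<close> has order 2, so |\<Gamma>| is even and |K| is
      odd; squaring is then invertible on \<open>K\<close>.\<close>
    have "2 dvd order \<Gamma>"
    proof -
      have "t [^]\<^bsub>\<Gamma>\<^esub> (2::nat) = \<one>\<^bsub>\<Gamma>\<^esub>" using tt t by (simp add: numeral_2_eq_2)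
      then have "\<Gamma>.ord t dvd 2" using t \<Gamma>.pow_eq_id by blast
      moreover have "\<Gamma>.ord t \<noteq> 1" using False t \<Gamma>.ord_eq_1 by blast
      moreover have "\<Gamma>.ord t \<le> 2" "\<Gamma>.ord t \<noteq> 0"
        using \<open>\<Gamma>.ord t dvd 2\<close> by (auto dest: dvd_imp_le intro: gr0I)
      ultimately have "\<Gamma>.ord t = 2" by linarith
      then show ?thesis using t \<Gamma>.ord_dvd_group_order by metis
    qed
    then have "coprime (order (ker_group G \<Gamma> \<pi>)) 2"
      using coprime_order by (meson coprime_divisors dvd_refl)
    then obtain m :: nat where m: "\<And>x. x \<in> K \<Longrightarrow> (x [^]\<^bsub>G\<^esub> (2::nat)) [^]\<^bsub>G\<^esub> m = x"
      by (rule M.pow_coprime_order_root[of 2, unfolded ker_group_simps pow_ker_group, OF finite_K]) blast+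
    define z where "z = C \<otimes>\<^bsub>G\<^esub> inv\<^bsub>G\<^esub> j t"
    have z: "z \<in> K" unfolding z_def using C t proj_j by (intro in_K) simp_all
    have inv_jt: "inv\<^bsub>G\<^esub> j t = j t" using jt t by (simp add: G.inv_equality)
    have act_t: "act t x = j t \<otimes>\<^bsub>G\<^esub> x \<otimes>\<^bsub>G\<^esub> inv\<^bsub>G\<^esub> j t" if "x \<in> K" for x
      using act_proj[of "j t" x] that t proj_j by simp
    have inv_C: "inv\<^bsub>G\<^esub> C = C" using C by (simp add: G.inv_equality)
    \<comment> \<open>Since \<open>C\<close> and \<open>j t\<close> both square to the unit,
      \<open>t\<close> acts on \<open>z\<close> by inversion.\<close>
    have "act t z \<otimes>\<^bsub>G\<^esub> z = \<one>\<^bsub>G\<^esub>"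
      using z C t jt G.inv_mult_cancel_left(1)[of "j t"] G.inv_mult_cancel_left(1)[of C]
      by (simp add: act_t) (simp add: z_def inv_jt inv_C G.m_assoc)
    then have act_z: "inv\<^bsub>G\<^esub> (act t z) = z"
      using z t by (metis G.inv_equality G.inv_inv K_carrier act_K)
    \<comment> \<open>This is the square root of \<open>z\<close> in \<open>K\<close>. It is
      inverted by \<open>t\<close> as well, so \<open>k\<close> divided by \<open>act t k\<close> is
      the square of \<open>k\<close>, namely \<open>z\<close>.\<close>
    define k where "k = z [^]\<^bsub>G\<^esub> m"
    have k: "k \<in> K" using z M.nat_pow_closed[of z m] by (simp add: k_def)
    have "inv\<^bsub>G\<^esub> (act t k) = k"
      using M.action_pow[of t z m] z t act_z by (simp add: k_def G.nat_pow_inv[symmetric])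
    then have "k \<otimes>\<^bsub>G\<^esub> inv\<^bsub>G\<^esub> (act t k) = (z [^]\<^bsub>G\<^esub> (2::nat)) [^]\<^bsub>G\<^esub> m"
      using z by (simp add: k_def G.nat_pow_pow G.nat_pow_mult mult_2)
    then have "k \<otimes>\<^bsub>G\<^esub> inv\<^bsub>G\<^esub> (act t k) = z" using m z by simp
    then have "k \<otimes>\<^bsub>G\<^esub> (j t \<otimes>\<^bsub>G\<^esub> inv\<^bsub>G\<^esub> k \<otimes>\<^bsub>G\<^esub> inv\<^bsub>G\<^esub> j t) \<otimes>\<^bsub>G\<^esub> j t = C"
      using k t C by (simp add: act_t G.inv_mult_group G.m_assoc z_def)
    then have "k \<otimes>\<^bsub>G\<^esub> j t \<otimes>\<^bsub>G\<^esub> inv\<^bsub>G\<^esub> k = C"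
      using k t by (simp add: G.m_assoc)
    then show ?thesis using that k by blast
  qed
  define \<iota> where "\<iota> g = k \<otimes>\<^bsub>G\<^esub> j g \<otimes>\<^bsub>G\<^esub> inv\<^bsub>G\<^esub> k" for g
  show ?thesis
  proof (rule that[of \<iota>])
    show "\<iota> \<in> hom \<Gamma> G"
      using k by (auto simp: hom_def \<iota>_def G.m_assoc G.inv_mult_cancel_left)
    show "\<pi> (\<iota> g) = g" if "g \<in> carrier \<Gamma>" for g
      using that k proj_j by (simp add: \<iota>_def)
    show "\<iota> (s \<sigma>) = c \<sigma>" if "\<sigma> \<in> carrier Gal_CR" for \<sigma>
    proof -
      have "s id = \<one>\<^bsub>\<Gamma>\<^esub>" using proj_c[OF id_Gal] c_id by simp
      then show ?thesis
        using that kj k c_id by (auto simp: carrier_Gal_CR \<iota>_def t_def C_def)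
    qed
  qed
qed

end

section \<open>Isomorphisms of split triples\<close>

locale split_triple = class_triple_context \<Gamma> s G c \<pi>
  for \<Gamma> :: "'g monoid" and s and G :: "'a monoid" and c and \<pi> +
  fixes \<iota> :: "'g \<Rightarrow> 'a"
  assumes section_hom: "\<iota> \<in> hom \<Gamma> G"
    and proj_section [simp]: "g \<in> carrier \<Gamma> \<Longrightarrow> \<pi> (\<iota> g) = g"
    and section_s: "\<sigma> \<in> carrier Gal_CR \<Longrightarrow> \<iota> (s \<sigma>) = c \<sigma>"
begin

lemma section_closed [simp]: "g \<in> carrier \<Gamma> \<Longrightarrow> \<iota> g \<in> carrier G"
  and section_mult: "g \<in> carrier \<Gamma> \<Longrightarrow> h \<in> carrier \<Gamma> \<Longrightarrow> \<iota> (g \<otimes>\<^bsub>\<Gamma>\<^esub> h) = \<iota> g \<otimes>\<^bsub>G\<^esub> \<iota> h"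
  using section_hom by (auto simp: hom_def)

lemma section_one: "\<iota> \<one>\<^bsub>\<Gamma>\<^esub> = \<one>\<^bsub>G\<^esub>"
  using section_hom group_base G.is_group
  by (metis group_hom.hom_one group_hom.intro group_hom_axioms.intro)

lemma act_section: "g \<in> carrier \<Gamma> \<Longrightarrow> k \<in> K \<Longrightarrow> act g k = \<iota> g \<otimes>\<^bsub>G\<^esub> k \<otimes>\<^bsub>G\<^esub> inv\<^bsub>G\<^esub> \<iota> g"
  using act_proj[of "\<iota> g" k] by simp

text \<open>The \<open>K\<close>-coordinate of \<open>x\<close> when \<open>G\<close> is viewed as
  the semidirect product of \<open>K\<close> and the image of \<iota>; the other coordinate is
  \<open>\<pi> x\<close>.\<close>

definition ker_part :: "'a \<Rightarrow> 'a" where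
  "ker_part x = x \<otimes>\<^bsub>G\<^esub> inv\<^bsub>G\<^esub> \<iota> (\<pi> x)"

lemma ker_part_K [simp]: "x \<in> carrier G \<Longrightarrow> ker_part x \<in> K"
  unfolding ker_part_def by (rule in_K) simp_all

lemma decompose: "x \<in> carrier G \<Longrightarrow> ker_part x \<otimes>\<^bsub>G\<^esub> \<iota> (\<pi> x) = x"
  by (simp add: ker_part_def G.m_assoc)

lemma ker_part_compose:
  "k \<in> K \<Longrightarrow> g \<in> carrier \<Gamma> \<Longrightarrow> ker_part (k \<otimes>\<^bsub>G\<^esub> \<iota> g) = k"
  by (simp add: ker_part_def G.m_assoc)

text \<open>This is semidirect product multiplication in these coordinates; it makes
  \<open>twist\<close> below multiplicative.\<close>

lemma ker_part_mult:
  assumes "x \<in> carrier G" "y \<in> carrier G"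
  shows "ker_part (x \<otimes>\<^bsub>G\<^esub> y) = ker_part x \<otimes>\<^bsub>G\<^esub> act (\<pi> x) (ker_part y)"
  using assms
  by (simp add: act_section)
     (simp add: ker_part_def section_mult G.m_assoc G.inv_mult_group G.inv_mult_cancel_left)

end

section \<open>Parametrising the isomorphisms between two split triples\<close>

locale split_triple_pair =
  A: split_triple \<Gamma> s G1 c1 \<pi>1 \<iota>1 + B: split_triple \<Gamma> s G2 c2 \<pi>2 \<iota>2
  for \<Gamma> :: "'g monoid" and s
    and G1 :: "'a monoid" and c1 \<pi>1 \<iota>1
    and G2 :: "'b monoid" and c2 \<pi>2 \<iota>2
begin

text \<open>For an isomorphism \<alpha> of kernels, this applies \<alpha> to the kernel part,
  carries \<open>\<iota>1 g\<close> to \<open>\<iota>2 g\<close>, and conjugates the result by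
  \<open>k\<close>. When \<open>k\<close> lies in the abelian kernel, the conjugation moves only the
  section, and the restriction to the kernel remains \<alpha>.\<close>

definition twist :: "'b \<Rightarrow> ('a \<Rightarrow> 'b) \<Rightarrow> 'a \<Rightarrow> 'b" where
  "twist k \<alpha> = (\<lambda>x\<in>carrier G1.
     k \<otimes>\<^bsub>G2\<^esub> (\<alpha> (A.ker_part x) \<otimes>\<^bsub>G2\<^esub> \<iota>2 (\<pi>1 x)) \<otimes>\<^bsub>G2\<^esub> inv\<^bsub>G2\<^esub> k)"

text \<open>Extensionality makes \<alpha> determined by its values on the kernel; for two equal
  triples this set is \<open>module_Aut\<close>.\<close>

abbreviation module_isos :: "('a \<Rightarrow> 'b) set" where
  "module_isos \<equiv>
     module_iso \<Gamma> (ker_group G1 \<Gamma> \<pi>1) A.act (ker_group G2 \<Gamma> \<pi>2) B.act \<inter> extensional A.K"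

abbreviation fixed_kernel :: "'b set" where
  "fixed_kernel \<equiv> fixed_points (s ` carrier Gal_CR) (ker_group G2 \<Gamma> \<pi>2) B.act"

lemma module_isosD:
  assumes "\<alpha> \<in> module_isos"
  shows "x \<in> A.K \<Longrightarrow> \<alpha> x \<in> B.K"
    and "x \<in> A.K \<Longrightarrow> y \<in> A.K \<Longrightarrow> \<alpha> (x \<otimes>\<^bsub>G1\<^esub> y) = \<alpha> x \<otimes>\<^bsub>G2\<^esub> \<alpha> y"
    and "g \<in> carrier \<Gamma> \<Longrightarrow> x \<in> A.K \<Longrightarrow> \<alpha> (A.act g x) = B.act g (\<alpha> x)"
    and "bij_betw \<alpha> A.K B.K"
  using assms by (auto simp: module_iso_def iso_def hom_def)

lemma module_isos_one:
  assumes "\<alpha> \<in> module_isos"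
  shows "\<alpha> \<one>\<^bsub>G1\<^esub> = \<one>\<^bsub>G2\<^esub>"
proof -
  have "\<alpha> \<one>\<^bsub>G1\<^esub> \<otimes>\<^bsub>G2\<^esub> \<alpha> \<one>\<^bsub>G1\<^esub> = \<alpha> \<one>\<^bsub>G1\<^esub>"
    using module_isosD(2)[OF assms, of "\<one>\<^bsub>G1\<^esub>" "\<one>\<^bsub>G1\<^esub>"] by simp
  moreover have "\<alpha> \<one>\<^bsub>G1\<^esub> \<in> carrier G2"
    using module_isosD(1)[OF assms, of "\<one>\<^bsub>G1\<^esub>"] by simp
  ultimately show ?thesis by simp
qed

text \<open>The element \<open>s \<sigma>\<close> acts as conjugation by its lift
  \<open>c2 \<sigma>\<close>, so either side says that \<open>k\<close> commutes with
  \<open>c2 \<sigma>\<close>. The right-hand form is what lets \<open>twist\<close> carry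
  \<open>c1\<close> to \<open>c2\<close>.\<close>

lemma fixed_kernel_iff:
  "k \<in> fixed_kernel \<longleftrightarrow> k \<in> B.K \<and> (\<forall>\<sigma>\<in>carrier Gal_CR. k \<otimes>\<^bsub>G2\<^esub> c2 \<sigma> \<otimes>\<^bsub>G2\<^esub> inv\<^bsub>G2\<^esub> k = c2 \<sigma>)"
proof -
  have "B.act (s \<sigma>) k = k \<longleftrightarrow> k \<otimes>\<^bsub>G2\<^esub> c2 \<sigma> \<otimes>\<^bsub>G2\<^esub> inv\<^bsub>G2\<^esub> k = c2 \<sigma>"
    if k: "k \<in> B.K" and \<sigma>: "\<sigma> \<in> carrier Gal_CR" for k \<sigma>
  proof -
    have c: "c2 \<sigma> \<in> carrier G2" by (rule B.c_closed[OF \<sigma>])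
    have "B.act (s \<sigma>) k = c2 \<sigma> \<otimes>\<^bsub>G2\<^esub> k \<otimes>\<^bsub>G2\<^esub> inv\<^bsub>G2\<^esub> c2 \<sigma>"
      using B.act_proj[OF c k] B.proj_c[OF \<sigma>] by simp
    moreover have "c2 \<sigma> \<otimes>\<^bsub>G2\<^esub> k \<otimes>\<^bsub>G2\<^esub> inv\<^bsub>G2\<^esub> c2 \<sigma> = k \<longleftrightarrow> c2 \<sigma> \<otimes>\<^bsub>G2\<^esub> k = k \<otimes>\<^bsub>G2\<^esub> c2 \<sigma>"
      using c k by (metis B.G.inv_solve_right' B.G.m_closed B.K_carrier)
    moreover have "k \<otimes>\<^bsub>G2\<^esub> c2 \<sigma> \<otimes>\<^bsub>G2\<^esub> inv\<^bsub>G2\<^esub> k = c2 \<sigma> \<longleftrightarrow> k \<otimes>\<^bsub>G2\<^esub> c2 \<sigma> = c2 \<sigma> \<otimes>\<^bsub>G2\<^esub> k"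
      using c k by (metis B.G.inv_solve_right' B.G.m_closed B.K_carrier)
    ultimately show ?thesis by auto
  qed
  then show ?thesis by (auto simp: fixed_points_def)
qed

lemma twist_eq:
  "x \<in> carrier G1 \<Longrightarrow>
    twist k \<alpha> x = k \<otimes>\<^bsub>G2\<^esub> (\<alpha> (A.ker_part x) \<otimes>\<^bsub>G2\<^esub> \<iota>2 (\<pi>1 x)) \<otimes>\<^bsub>G2\<^esub> inv\<^bsub>G2\<^esub> k"
  by (simp add: twist_def)

lemma twist_triple_hom:
  assumes k: "k \<in> fixed_kernel" and \<alpha>: "\<alpha> \<in> module_isos"
  shows "twist k \<alpha> \<in> triple_hom (G1, c1, \<pi>1) (G2, c2, \<pi>2)"
proof -
  note a = module_isosD[OF \<alpha>]
  have kK: "k \<in> B.K" using k by (simp add: fixed_kernel_iff)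
  have closed: "twist k \<alpha> x \<in> carrier G2" if "x \<in> carrier G1" for x
    using that kK a(1) by (simp add: twist_eq)
  have mult: "twist k \<alpha> (x \<otimes>\<^bsub>G1\<^esub> y) = twist k \<alpha> x \<otimes>\<^bsub>G2\<^esub> twist k \<alpha> y"
    if x: "x \<in> carrier G1" and y: "y \<in> carrier G1" for x y
  proof -
    define u v where "u = \<alpha> (A.ker_part x)" and "v = \<alpha> (A.ker_part y)"
    have uv: "u \<in> B.K" "v \<in> B.K" using x y a(1) by (simp_all add: u_def v_def)
    \<comment> \<open>Equivariance of \<alpha> turns the action inside \<open>G1\<close> into that
      inside \<open>G2\<close>, which is conjugation by the values of \<iota>2.\<close>
    have "\<alpha> (A.ker_part (x \<otimes>\<^bsub>G1\<^esub> y)) = u \<otimes>\<^bsub>G2\<^esub> (\<iota>2 (\<pi>1 x) \<otimes>\<^bsub>G2\<^esub> v \<otimes>\<^bsub>G2\<^esub> inv\<^bsub>G2\<^esub> \<iota>2 (\<pi>1 x))"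
      using x y uv by (simp add: A.ker_part_mult a(2,3) B.act_section u_def v_def)
    then show ?thesis
      using x y uv kK
      by (simp add: twist_eq B.section_mult flip: u_def v_def)
         (simp add: B.G.m_assoc B.G.inv_mult_cancel_left)
  qed
  have "\<pi>2 (twist k \<alpha> x) = \<pi>1 x" if "x \<in> carrier G1" for x
    using that kK a(1) by (simp add: twist_eq)
  moreover have "twist k \<alpha> (c1 \<sigma>) = c2 \<sigma>" if \<sigma>: "\<sigma> \<in> carrier Gal_CR" for \<sigma>
  proof -
    \<comment> \<open>The element \<open>c1 \<sigma>\<close> lies on the section, being
      \<open>\<iota>1 (s \<sigma>)\<close>; hence \<open>twist\<close> sends it to the conjugate of
      \<open>c2 \<sigma>\<close> by \<open>k\<close>.\<close>
    have "A.ker_part (c1 \<sigma>) = \<one>\<^bsub>G1\<^esub>"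
      using A.c_closed[OF \<sigma>] A.proj_c[OF \<sigma>] A.section_s[OF \<sigma>] by (simp add: A.ker_part_def)
    then show ?thesis
      using A.c_closed[OF \<sigma>] A.proj_c[OF \<sigma>] B.section_s[OF \<sigma>] B.c_closed[OF \<sigma>] k \<sigma>
      by (simp add: twist_eq module_isos_one[OF \<alpha>] fixed_kernel_iff)
  qed
  ultimately show ?thesis
    using closed mult by (auto simp: hom_def twist_def)
qed

lemma twist_bij:
  assumes k: "k \<in> B.K" and \<alpha>: "\<alpha> \<in> module_isos"
  shows "bij_betw (twist k \<alpha>) (carrier G1) (carrier G2)"
proof -
  note a = module_isosD[OF \<alpha>]
  have inv_a: "inv_into A.K \<alpha> y \<in> A.K" "\<alpha> (inv_into A.K \<alpha> y) = y" if "y \<in> B.K" for y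
    using that a(4) by (auto simp: bij_betw_def inv_into_into f_inv_into_f)
  have a_inv: "inv_into A.K \<alpha> (\<alpha> x) = x" if "x \<in> A.K" for x
    using that a(4) by (auto simp: bij_betw_def)
  define conj where "conj y = inv\<^bsub>G2\<^esub> k \<otimes>\<^bsub>G2\<^esub> y \<otimes>\<^bsub>G2\<^esub> k" for y
  \<comment> \<open>The inverse map: undo the conjugation, pull the kernel part back along \<alpha>,
    and attach the section value. Since \<open>k\<close> projects to the unit, \<open>y\<close> and
    \<open>conj y\<close> have the same projection.\<close>
  define w where "w y = inv_into A.K \<alpha> (B.ker_part (conj y)) \<otimes>\<^bsub>G1\<^esub> \<iota>1 (\<pi>2 y)" for y
  have conj: "conj y \<in> carrier G2" "\<pi>2 (conj y) = \<pi>2 y" if "y \<in> carrier G2" for y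
    using that k by (simp_all add: conj_def)
  have conj_twist: "conj (twist k \<alpha> x) = \<alpha> (A.ker_part x) \<otimes>\<^bsub>G2\<^esub> \<iota>2 (\<pi>1 x)"
    if "x \<in> carrier G1" for x
    using that k a(1) by (simp add: twist_eq conj_def B.G.m_assoc B.G.inv_mult_cancel_left)
  have proj_twist: "\<pi>2 (twist k \<alpha> x) = \<pi>1 x" if "x \<in> carrier G1" for x
    using that k a(1) by (simp add: twist_eq)
  show ?thesis
  proof (rule bij_betw_byWitness[where f' = w])
    show "\<forall>x\<in>carrier G1. w (twist k \<alpha> x) = x"
      using a(1) by (simp add: w_def conj_twist proj_twist B.ker_part_compose a_inv A.decompose)
    show "\<forall>y\<in>carrier G2. twist k \<alpha> (w y) = y"
    proof
      fix y assume y: "y \<in> carrier G2"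
      then have "twist k \<alpha> (w y) = k \<otimes>\<^bsub>G2\<^esub> conj y \<otimes>\<^bsub>G2\<^esub> inv\<^bsub>G2\<^esub> k"
        using conj[OF y] inv_a[of "B.ker_part (conj y)"] B.decompose[of "conj y"]
        by (simp add: twist_eq w_def A.ker_part_compose)
      then show "twist k \<alpha> (w y) = y"
        using y k by (simp add: conj_def B.G.m_assoc B.G.inv_mult_cancel_left)
    qed
    show "twist k \<alpha> ` carrier G1 \<subseteq> carrier G2"
      using k a(1) by (auto simp: twist_eq)
    show "w ` carrier G2 \<subseteq> carrier G1"
      using conj inv_a by (auto simp: w_def)
  qed
qed

text \<open>The inverse of a bijective morphism is again a morphism, since compatibility with the
  projections and with \<open>c1\<close>, \<open>c2\<close> can be read backwards. Bijectivity thus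
  replaces the search for an inverse morphism.\<close>

lemma triple_iso_bij:
  "\<tau> \<in> triple_iso (G1, c1, \<pi>1) (G2, c2, \<pi>2) \<longleftrightarrow>
     \<tau> \<in> triple_hom (G1, c1, \<pi>1) (G2, c2, \<pi>2) \<and> bij_betw \<tau> (carrier G1) (carrier G2)"
proof (intro iffI conjI)
  assume "\<tau> \<in> triple_iso (G1, c1, \<pi>1) (G2, c2, \<pi>2)"
  then obtain \<rho> where \<tau>: "\<tau> \<in> triple_hom (G1, c1, \<pi>1) (G2, c2, \<pi>2)"
    and \<rho>: "\<rho> \<in> triple_hom (G2, c2, \<pi>2) (G1, c1, \<pi>1)"
    and 1: "compose (carrier G1) \<rho> \<tau> = (\<lambda>x\<in>carrier G1. x)"
    and 2: "compose (carrier G2) \<tau> \<rho> = (\<lambda>y\<in>carrier G2. y)"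
    by auto
  show "\<tau> \<in> triple_hom (G1, c1, \<pi>1) (G2, c2, \<pi>2)" by fact
  show "bij_betw \<tau> (carrier G1) (carrier G2)"
  proof (rule bij_betw_byWitness[where f' = \<rho>])
    show "\<forall>x\<in>carrier G1. \<rho> (\<tau> x) = x" using 1 by (metis compose_eq restrict_apply')
    show "\<forall>y\<in>carrier G2. \<tau> (\<rho> y) = y" using 2 by (metis compose_eq restrict_apply')
  qed (use \<tau> \<rho> in \<open>auto simp: hom_def\<close>)
next
  assume "\<tau> \<in> triple_hom (G1, c1, \<pi>1) (G2, c2, \<pi>2) \<and> bij_betw \<tau> (carrier G1) (carrier G2)"
  then have \<tau>: "\<tau> \<in> triple_hom (G1, c1, \<pi>1) (G2, c2, \<pi>2)"
    and bij: "bij_betw \<tau> (carrier G1) (carrier G2)" by auto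
  \<comment> \<open>The restriction makes the inverse extensional, as \<open>triple_hom\<close>
    demands.\<close>
  define \<rho> where "\<rho> = restrict (inv_into (carrier G1) \<tau>) (carrier G2)"
  have \<rho>1: "\<rho> (\<tau> x) = x" if "x \<in> carrier G1" for x
    using that bij by (auto simp: \<rho>_def bij_betw_def)
  have \<rho>2: "\<rho> y \<in> carrier G1" "\<tau> (\<rho> y) = y" if "y \<in> carrier G2" for y
    using that bij by (auto simp: \<rho>_def bij_betw_def inv_into_into f_inv_into_f)
  have iso: "\<tau> \<in> iso G1 G2" using \<tau> bij by (simp add: iso_def)
  have "\<rho> \<in> hom G2 G1"
    using A.G.iso_set_sym[OF iso] by (auto simp: \<rho>_def iso_def hom_def)
  moreover have "\<rho> (c2 \<sigma>) = c1 \<sigma>" if "\<sigma> \<in> carrier Gal_CR" for \<sigma>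
    using \<rho>1[OF A.c_closed[OF that]] \<tau> that by simp
  moreover have "\<pi>2 y = \<pi>1 (\<rho> y)" if "y \<in> carrier G2" for y
    using \<rho>2[OF that] \<tau> by simp
  ultimately have "\<rho> \<in> triple_hom (G2, c2, \<pi>2) (G1, c1, \<pi>1)"
    by (simp add: \<rho>_def)
  moreover have "compose (carrier G1) \<rho> \<tau> = (\<lambda>x\<in>carrier G1. x)"
    by (rule extensionalityI) (auto simp: compose_eq \<rho>1)
  moreover have "compose (carrier G2) \<tau> \<rho> = (\<lambda>y\<in>carrier G2. y)"
    by (rule extensionalityI) (auto simp: compose_eq \<rho>2)
  ultimately show "\<tau> \<in> triple_iso (G1, c1, \<pi>1) (G2, c2, \<pi>2)"
    using \<tau> by auto
qed

text \<open>Both \<iota>2 and \<tau> after \<iota>1 are homomorphic sections of \<pi>2. They differ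
  by a 1-cocycle, so some \<open>k\<close> in the kernel conjugates one to the other. With \<alpha>
  the restriction of \<tau>, the map \<open>twist k \<alpha>\<close> agrees with \<tau> on the
  kernel and on the section, which generate \<open>G1\<close>.\<close>

lemma triple_iso_is_twist:
  assumes \<tau>: "\<tau> \<in> triple_iso (G1, c1, \<pi>1) (G2, c2, \<pi>2)"
  obtains k \<alpha> where "k \<in> fixed_kernel" "\<alpha> \<in> module_isos" "\<tau> = twist k \<alpha>"
proof -
  have \<tau>h: "\<tau> \<in> triple_hom (G1, c1, \<pi>1) (G2, c2, \<pi>2)"
    and bij: "bij_betw \<tau> (carrier G1) (carrier G2)"
    using \<tau> by (simp_all only: triple_iso_bij)
  interpret \<tau>: group_hom G1 G2 \<tau>
    using \<tau>h by (simp add: group_hom_def group_hom_axioms_def A.G.is_group B.G.is_group)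
  have proj: "\<pi>2 (\<tau> x) = \<pi>1 x" if "x \<in> carrier G1" for x
    using \<tau>h that by simp
  have \<tau>c: "\<tau> (c1 \<sigma>) = c2 \<sigma>" if "\<sigma> \<in> carrier Gal_CR" for \<sigma>
    using \<tau>h that by simp
  have \<tau>K: "\<tau> x \<in> B.K" if "x \<in> A.K" for x
    using that proj[of x] by (intro B.in_K) auto
  define \<alpha> where "\<alpha> = restrict \<tau> A.K"
  have "bij_betw \<alpha> A.K B.K"
    unfolding bij_betw_def
  proof
    show "inj_on \<alpha> A.K"
      using bij by (auto simp: \<alpha>_def bij_betw_def inj_on_def)
    have "y \<in> \<tau> ` A.K" if y: "y \<in> B.K" for y
    proof -
      have "y \<in> \<tau> ` carrier G1" using y bij by (simp add: bij_betw_def)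
      then obtain x where x: "x \<in> carrier G1" "y = \<tau> x" by blast
      then have "x \<in> A.K" using y proj[of x] by (intro A.in_K) auto
      then show ?thesis using x by blast
    qed
    then show "\<alpha> ` A.K = B.K" using \<tau>K by (auto simp: \<alpha>_def)
  qed
  \<comment> \<open>The element \<open>\<tau> (\<iota>1 g)\<close> is a lift of \<open>g\<close> to
    \<open>G2\<close>, and any lift computes \<open>B.act g\<close>.\<close>
  moreover have "\<alpha> (A.act g x) = B.act g (\<alpha> x)" if "g \<in> carrier \<Gamma>" "x \<in> A.K" for g x
    using that B.act_proj[of "\<tau> (\<iota>1 g)" "\<tau> x"] \<tau>K proj[of "\<iota>1 g"]
    by (simp add: \<alpha>_def) (simp add: A.act_section)
  ultimately have \<alpha>: "\<alpha> \<in> module_isos"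
    using \<tau>K by (auto simp: module_iso_def iso_def hom_def \<alpha>_def)
  define z where "z g = \<tau> (\<iota>1 g) \<otimes>\<^bsub>G2\<^esub> inv\<^bsub>G2\<^esub> \<iota>2 g" for g
  have z: "z g \<in> B.K" if "g \<in> carrier \<Gamma>" for g
    unfolding z_def using that by (intro B.in_K) (simp_all add: proj)
  have cocycle: "z (g \<otimes>\<^bsub>\<Gamma>\<^esub> h) = z g \<otimes>\<^bsub>G2\<^esub> B.act g (z h)"
    if "g \<in> carrier \<Gamma>" "h \<in> carrier \<Gamma>" for g h
    using that z[of h]
    by (simp add: B.act_section)
       (simp add: z_def A.section_mult B.section_mult B.G.m_assoc B.G.inv_mult_group B.G.inv_mult_cancel_left)
  obtain k where k: "k \<in> B.K" and zk: "\<And>g. g \<in> carrier \<Gamma> \<Longrightarrow> z g \<otimes>\<^bsub>G2\<^esub> B.act g k = k"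
    using B.M.one_cocycle_is_coboundary[of z, unfolded B.ker_group_simps, OF B.finite_K B.coprime_order _ cocycle] z
    by blast
  have \<tau>\<iota>: "\<tau> (\<iota>1 g) = k \<otimes>\<^bsub>G2\<^esub> \<iota>2 g \<otimes>\<^bsub>G2\<^esub> inv\<^bsub>G2\<^esub> k" if g: "g \<in> carrier \<Gamma>" for g
  proof -
    have "k = \<tau> (\<iota>1 g) \<otimes>\<^bsub>G2\<^esub> k \<otimes>\<^bsub>G2\<^esub> inv\<^bsub>G2\<^esub> \<iota>2 g"
      using zk[OF g] g k
      by (simp add: B.act_section) (simp add: z_def B.G.m_assoc B.G.inv_mult_cancel_left)
    then have "k \<otimes>\<^bsub>G2\<^esub> \<iota>2 g = \<tau> (\<iota>1 g) \<otimes>\<^bsub>G2\<^esub> k"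
      using g k B.G.inv_solve_right[of k "\<tau> (\<iota>1 g) \<otimes>\<^bsub>G2\<^esub> k" "\<iota>2 g"] by simp
    then show ?thesis using g k by (simp add: B.G.m_assoc)
  qed
  \<comment> \<open>At \<open>s \<sigma>\<close> the two sections take the values
    \<open>c1 \<sigma>\<close> and \<open>c2 \<sigma>\<close>, so there \<open>\<tau>\<iota>\<close>
    says that conjugation by \<open>k\<close> fixes \<open>c2 \<sigma>\<close>.\<close>
  have "k \<in> fixed_kernel"
    using k \<tau>\<iota>[OF A.s_closed] A.section_s B.section_s \<tau>c by (simp add: fixed_kernel_iff)
  moreover have "\<tau> = twist k \<alpha>"
  proof (rule extensionalityI)
    show "\<tau> \<in> extensional (carrier G1)" using \<tau>h by simp
    show "twist k \<alpha> \<in> extensional (carrier G1)" by (simp add: twist_def)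
    fix x assume x: "x \<in> carrier G1"
    define u where "u = \<alpha> (A.ker_part x)"
    have u: "u \<in> B.K" "u = \<tau> (A.ker_part x)" using x \<tau>K by (simp_all add: u_def \<alpha>_def)
    have "\<tau> x = \<tau> (A.ker_part x \<otimes>\<^bsub>G1\<^esub> \<iota>1 (\<pi>1 x))" using A.decompose[OF x] by simp
    also have "\<dots> = u \<otimes>\<^bsub>G2\<^esub> k \<otimes>\<^bsub>G2\<^esub> \<iota>2 (\<pi>1 x) \<otimes>\<^bsub>G2\<^esub> inv\<^bsub>G2\<^esub> k"
      using x u k by (simp add: \<tau>\<iota> B.G.m_assoc)
    also have "\<dots> = twist k \<alpha> x"
      using x u(1) k by (simp add: twist_eq B.K_comm[of u k] B.G.m_assoc flip: u_def)
    finally show "\<tau> x = twist k \<alpha> x" .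
  qed
  ultimately show ?thesis using that \<alpha> by blast
qed

text \<open>On the kernel, conjugation by \<open>k\<close> is trivial, so a twist determines
  \<alpha>. On the section, equality of two twists says that the inverse of \<open>l\<close> times
  \<open>k\<close> commutes with every \<open>\<iota>2 g\<close>; this element is therefore
  \<Gamma>-invariant, hence the unit.\<close>

lemma twist_inj: "inj_on (\<lambda>(k, \<alpha>). twist k \<alpha>) (fixed_kernel \<times> module_isos)"
proof (rule inj_onI, clarify)
  fix k \<alpha> l \<beta>
  assume k: "k \<in> fixed_kernel" and l: "l \<in> fixed_kernel"
    and \<alpha>: "\<alpha> \<in> module_iso \<Gamma> (ker_group G1 \<Gamma> \<pi>1) A.act (ker_group G2 \<Gamma> \<pi>2) B.act" "\<alpha> \<in> extensional A.K"
    and \<beta>: "\<beta> \<in> module_iso \<Gamma> (ker_group G1 \<Gamma> \<pi>1) A.act (ker_group G2 \<Gamma> \<pi>2) B.act" "\<beta> \<in> extensional A.K"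
    and eq: "twist k \<alpha> = twist l \<beta>"
  have \<alpha>': "\<alpha> \<in> module_isos" and \<beta>': "\<beta> \<in> module_isos" using \<alpha> \<beta> by auto
  have kK: "k \<in> B.K" and lK: "l \<in> B.K" using k l by (auto simp: fixed_kernel_iff)
  have on_K: "twist k' \<alpha>' x = \<alpha>' x" if "k' \<in> B.K" "\<alpha>' \<in> module_isos" "x \<in> A.K" for k' \<alpha>' x
  proof -
    have ax: "\<alpha>' x \<in> B.K" using module_isosD(1)[OF that(2,3)] .
    have "A.ker_part x = x" using that(3) by (simp add: A.ker_part_def A.section_one)
    then show ?thesis
      using that ax by (simp add: twist_eq B.section_one B.K_comm[of k'] B.G.m_assoc)
  qed
  have "\<alpha> = \<beta>"
    by (rule extensionalityI[OF \<alpha>(2) \<beta>(2)]) (use eq on_K kK lK \<alpha>' \<beta>' in metis)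
  moreover have "k = l"
  proof -
    have "B.act g (inv\<^bsub>G2\<^esub> l \<otimes>\<^bsub>G2\<^esub> k) = inv\<^bsub>G2\<^esub> l \<otimes>\<^bsub>G2\<^esub> k" if g: "g \<in> carrier \<Gamma>" for g
    proof -
      have "A.ker_part (\<iota>1 g) = \<one>\<^bsub>G1\<^esub>" using g by (simp add: A.ker_part_def)
      then have "k \<otimes>\<^bsub>G2\<^esub> \<iota>2 g \<otimes>\<^bsub>G2\<^esub> inv\<^bsub>G2\<^esub> k = l \<otimes>\<^bsub>G2\<^esub> \<iota>2 g \<otimes>\<^bsub>G2\<^esub> inv\<^bsub>G2\<^esub> l"
        using fun_cong[OF eq, of "\<iota>1 g"] g kK lK module_isos_one[OF \<alpha>'] module_isos_one[OF \<beta>']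
        by (simp add: twist_eq)
      \<comment> \<open>The outer factors are chosen so that the left side cancels to the conjugate
        by \<open>\<iota>2 g\<close> of the inverse of \<open>l\<close> times \<open>k\<close>, and
        the right side to that element itself.\<close>
      then have "inv\<^bsub>G2\<^esub> l \<otimes>\<^bsub>G2\<^esub> (l \<otimes>\<^bsub>G2\<^esub> \<iota>2 g \<otimes>\<^bsub>G2\<^esub> inv\<^bsub>G2\<^esub> l) \<otimes>\<^bsub>G2\<^esub> k \<otimes>\<^bsub>G2\<^esub> inv\<^bsub>G2\<^esub> \<iota>2 g
          = inv\<^bsub>G2\<^esub> l \<otimes>\<^bsub>G2\<^esub> (k \<otimes>\<^bsub>G2\<^esub> \<iota>2 g \<otimes>\<^bsub>G2\<^esub> inv\<^bsub>G2\<^esub> k) \<otimes>\<^bsub>G2\<^esub> k \<otimes>\<^bsub>G2\<^esub> inv\<^bsub>G2\<^esub> \<iota>2 g"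
        by simp
      then have "\<iota>2 g \<otimes>\<^bsub>G2\<^esub> (inv\<^bsub>G2\<^esub> l \<otimes>\<^bsub>G2\<^esub> k) \<otimes>\<^bsub>G2\<^esub> inv\<^bsub>G2\<^esub> \<iota>2 g = inv\<^bsub>G2\<^esub> l \<otimes>\<^bsub>G2\<^esub> k"
        using g kK lK by (simp add: B.G.m_assoc B.G.inv_mult_cancel_left)
      then show ?thesis
        using g kK lK by (simp add: B.act_section)
    qed
    then have "inv\<^bsub>G2\<^esub> l \<otimes>\<^bsub>G2\<^esub> k = \<one>\<^bsub>G2\<^esub>" using kK lK by (intro B.fixed_trivial) auto
    then have "l \<otimes>\<^bsub>G2\<^esub> (inv\<^bsub>G2\<^esub> l \<otimes>\<^bsub>G2\<^esub> k) = l" using lK by simp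
    then show ?thesis using kK lK by (simp add: B.G.inv_mult_cancel_left)
  qed
  ultimately show "k = l \<and> \<alpha> = \<beta>" by simp
qed

lemma triple_iso_param:
  "bij_betw (\<lambda>(k, \<alpha>). twist k \<alpha>) (fixed_kernel \<times> module_isos) (triple_iso (G1, c1, \<pi>1) (G2, c2, \<pi>2))"
proof -
  have iso: "twist k \<alpha> \<in> triple_iso (G1, c1, \<pi>1) (G2, c2, \<pi>2)"
    if "k \<in> fixed_kernel" "\<alpha> \<in> module_isos" for k \<alpha>
    using that twist_triple_hom twist_bij unfolding triple_iso_bij by (simp add: fixed_kernel_iff)
  have twist: "\<tau> \<in> (\<lambda>(k, \<alpha>). twist k \<alpha>) ` (fixed_kernel \<times> module_isos)"
    if \<tau>: "\<tau> \<in> triple_iso (G1, c1, \<pi>1) (G2, c2, \<pi>2)" for \<tau>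
  proof -
    obtain k \<alpha> where "k \<in> fixed_kernel" "\<alpha> \<in> module_isos" "\<tau> = twist k \<alpha>"
      using triple_iso_is_twist[OF \<tau>] .
    then show ?thesis by (intro image_eqI[of _ _ "(k, \<alpha>)"]) simp_all
  qed
  have "(\<lambda>(k, \<alpha>). twist k \<alpha>) ` (fixed_kernel \<times> module_isos)
      = triple_iso (G1, c1, \<pi>1) (G2, c2, \<pi>2)"
  proof
    show "triple_iso (G1, c1, \<pi>1) (G2, c2, \<pi>2)
        \<subseteq> (\<lambda>(k, \<alpha>). twist k \<alpha>) ` (fixed_kernel \<times> module_isos)"
      by (rule subsetI) (rule twist)
    show "(\<lambda>(k, \<alpha>). twist k \<alpha>) ` (fixed_kernel \<times> module_isos)
        \<subseteq> triple_iso (G1, c1, \<pi>1) (G2, c2, \<pi>2)"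
      by (rule image_subsetI) (simp only: mem_Times_iff case_prod_unfold iso)
  qed
  then show ?thesis
    using twist_inj by (simp only: bij_betw_def)
qed

end

section \<open>Existence and uniqueness\<close>

lemma module_iso_sym:
  assumes M1: "group_module \<Gamma> H1 \<phi>1" and M2: "group_module \<Gamma> H2 \<phi>2"
    and f: "f \<in> module_iso \<Gamma> H1 \<phi>1 H2 \<phi>2"
  shows "inv_into (carrier H1) f \<in> module_iso \<Gamma> H2 \<phi>2 H1 \<phi>1"
proof -
  interpret M1: group_module \<Gamma> H1 \<phi>1 by (rule M1)
  interpret M2: group_module \<Gamma> H2 \<phi>2 by (rule M2)
  have iso: "f \<in> iso H1 H2"
    and equiv: "\<And>g h. g \<in> carrier \<Gamma> \<Longrightarrow> h \<in> carrier H1 \<Longrightarrow> f (\<phi>1 g h) = \<phi>2 g (f h)"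
    using f by (auto simp: module_iso_def)
  have inj: "inj_on f (carrier H1)" and surj: "f ` carrier H1 = carrier H2"
    using iso by (auto simp: iso_def bij_betw_def)
  have "inv_into (carrier H1) f (\<phi>2 g h) = \<phi>1 g (inv_into (carrier H1) f h)"
    if "g \<in> carrier \<Gamma>" "h \<in> carrier H2" for g h
  proof -
    obtain x where "x \<in> carrier H1" "h = f x" using \<open>h \<in> carrier H2\<close> surj by blast
    then show ?thesis using that inj by (simp flip: equiv)
  qed
  then show ?thesis
    using M1.iso_set_sym[OF iso] by (simp add: module_iso_def)
qed

lemma module_iso_trans:
  assumes M1: "group_module \<Gamma> H1 \<phi>1"
    and f: "f \<in> module_iso \<Gamma> H1 \<phi>1 H2 \<phi>2" and h: "h \<in> module_iso \<Gamma> H2 \<phi>2 H3 \<phi>3"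
  shows "compose (carrier H1) h f \<in> module_iso \<Gamma> H1 \<phi>1 H3 \<phi>3"
proof -
  interpret M1: group_module \<Gamma> H1 \<phi>1 by (rule M1)
  have "f \<in> carrier H1 \<rightarrow> carrier H2" using f by (auto simp: module_iso_def iso_def hom_def)
  then show ?thesis
    using f h M1.iso_eq[OF iso_set_trans[of f H1 H2 h H3], of "compose (carrier H1) h f"]
    by (auto simp: module_iso_def compose_eq Pi_iff)
qed

section \<open>The semidirect product as a class triple\<close>

definition semidirect :: "'h monoid \<Rightarrow> 'g monoid \<Rightarrow> ('g \<Rightarrow> 'h \<Rightarrow> 'h) \<Rightarrow> ('h \<times> 'g) monoid" where
  "semidirect H \<Gamma> \<phi> =
     \<lparr>carrier = carrier H \<times> carrier \<Gamma>,
      mult = (\<lambda>(h, g) (h', g'). (h \<otimes>\<^bsub>H\<^esub> \<phi> g h', g \<otimes>\<^bsub>\<Gamma>\<^esub> g')),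
      one = (\<one>\<^bsub>H\<^esub>, \<one>\<^bsub>\<Gamma>\<^esub>)\<rparr>"

lemma semidirect_simps [simp]:
  "carrier (semidirect H \<Gamma> \<phi>) = carrier H \<times> carrier \<Gamma>"
  "(h, g) \<otimes>\<^bsub>semidirect H \<Gamma> \<phi>\<^esub> (h', g') = (h \<otimes>\<^bsub>H\<^esub> \<phi> g h', g \<otimes>\<^bsub>\<Gamma>\<^esub> g')"
  "\<one>\<^bsub>semidirect H \<Gamma> \<phi>\<^esub> = (\<one>\<^bsub>H\<^esub>, \<one>\<^bsub>\<Gamma>\<^esub>)"
  by (simp_all add: semidirect_def)

context group_module
begin

abbreviation S :: "('h \<times> 'g) monoid" where "S \<equiv> semidirect H \<Gamma> \<phi>"

lemma group_semidirect: "group S"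
proof (rule groupI)
  fix x y z assume "x \<in> carrier S" "y \<in> carrier S" "z \<in> carrier S"
  then show "x \<otimes>\<^bsub>S\<^esub> y \<otimes>\<^bsub>S\<^esub> z = x \<otimes>\<^bsub>S\<^esub> (y \<otimes>\<^bsub>S\<^esub> z)"
    by (cases x, cases y, cases z) (simp add: m_assoc \<Gamma>.m_assoc mult_action)
next
  fix x assume x: "x \<in> carrier S"
  obtain h g where hg: "x = (h, g)" by (cases x)
  \<comment> \<open>The pair stands for \<open>h\<close> times \<open>g\<close>. Its inverse is the
    inverse of \<open>g\<close> times the inverse of \<open>h\<close>, and moving the former to the
    right makes it act on the latter.\<close>
  have "(\<phi> (inv\<^bsub>\<Gamma>\<^esub> g) (inv\<^bsub>H\<^esub> h), inv\<^bsub>\<Gamma>\<^esub> g) \<otimes>\<^bsub>S\<^esub> x = \<one>\<^bsub>S\<^esub>"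
    using x hg by simp
  moreover have "(\<phi> (inv\<^bsub>\<Gamma>\<^esub> g) (inv\<^bsub>H\<^esub> h), inv\<^bsub>\<Gamma>\<^esub> g) \<in> carrier S"
    using x hg by simp
  ultimately show "\<exists>y\<in>carrier S. y \<otimes>\<^bsub>S\<^esub> x = \<one>\<^bsub>S\<^esub>" by blast
qed auto

lemma kernel_semidirect: "kernel S \<Gamma> snd = carrier H \<times> {\<one>\<^bsub>\<Gamma>\<^esub>}"
  by (auto simp: kernel_def)

lemma snd_hom_semidirect: "snd \<in> hom S \<Gamma>"
  by (auto simp: hom_def)

lemma comm_group_ker_semidirect: "comm_group (ker_group S \<Gamma> snd)"
proof -
  have "group (ker_group S \<Gamma> snd)"
    unfolding ker_group_def
    by (intro subgroup.subgroup_is_group group_hom.subgroup_kernel)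
       (simp_all add: group_hom_def group_hom_axioms_def group_semidirect group_acting snd_hom_semidirect)
  then show ?thesis
    by (rule group.group_comm_groupI) (auto simp: ker_group_def kernel_semidirect m_comm)
qed

text \<open>The action is defined through a chosen preimage of \<open>g\<close>; because the kernel
  is abelian, the preimage with trivial \<open>H\<close>-component may be used instead.\<close>

lemma conj_action_semidirect:
  assumes g: "g \<in> carrier \<Gamma>" and h: "h \<in> carrier H"
  shows "conj_action S \<Gamma> snd g (h, \<one>\<^bsub>\<Gamma>\<^esub>) = (\<phi> g h, \<one>\<^bsub>\<Gamma>\<^esub>)"
proof -
  have inv: "inv\<^bsub>S\<^esub> (\<one>\<^bsub>H\<^esub>, g) = (\<one>\<^bsub>H\<^esub>, inv\<^bsub>\<Gamma>\<^esub> g)"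
    using g by (intro group.inv_equality[OF group_semidirect]) auto
  show ?thesis
    using conj_action_eq[OF group_semidirect group_acting snd_hom_semidirect comm_group_ker_semidirect,
        of "(\<one>\<^bsub>H\<^esub>, g)" "(h, \<one>\<^bsub>\<Gamma>\<^esub>)"] g h
    by (simp add: kernel_semidirect inv)
qed

lemma fst_module_iso_semidirect:
  "fst \<in> module_iso \<Gamma> (ker_group S \<Gamma> snd) (conj_action S \<Gamma> snd) H \<phi>"
proof -
  have "bij_betw fst (carrier H \<times> {\<one>\<^bsub>\<Gamma>\<^esub>}) (carrier H)"
    by (rule bij_betw_byWitness[where f' = "\<lambda>h. (h, \<one>\<^bsub>\<Gamma>\<^esub>)"]) auto
  then show ?thesis
    by (auto simp: module_iso_def iso_def hom_def ker_group_def kernel_semidirect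
        conj_action_semidirect)
qed

text \<open>The lift of \<open>s\<close> goes through the standard section, whose image meets the
  kernel only in the unit; the fixed points of the kernel are those of \<open>H\<close>.\<close>

lemma class_triple_semidirect:
  assumes "finite (carrier \<Gamma>)" and s: "s \<in> hom Gal_CR \<Gamma>"
    and "finite (carrier H)" and cop: "coprime (order H) (order \<Gamma>)"
    and fixed: "fixed_points (carrier \<Gamma>) H \<phi> = {\<one>\<^bsub>H\<^esub>}"
  shows "class_triple \<Gamma> s (S, \<lambda>\<sigma>. (\<one>\<^bsub>H\<^esub>, s \<sigma>), snd)"
proof -
  have "snd \<in> epi S \<Gamma>"
    using snd_hom_semidirect one_closed by (force simp: epi_def)
  moreover have "order (ker_group S \<Gamma> snd) = order H"
    by (simp add: order_def ker_group_def kernel_semidirect card_cartesian_product)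
  moreover have "(\<lambda>\<sigma>. (\<one>\<^bsub>H\<^esub>, s \<sigma>)) \<in> hom Gal_CR S"
    using s by (auto simp: hom_def Pi_iff)
  moreover have "fixed_points (carrier \<Gamma>) (ker_group S \<Gamma> snd) (conj_action S \<Gamma> snd)
      = fixed_points (carrier \<Gamma>) H \<phi> \<times> {\<one>\<^bsub>\<Gamma>\<^esub>}"
    by (auto simp: fixed_points_def ker_group_def kernel_semidirect conj_action_semidirect)
  moreover have "(\<lambda>\<sigma>. (\<one>\<^bsub>H\<^esub>, s \<sigma>)) ` carrier Gal_CR \<inter> kernel S \<Gamma> snd = {(\<one>\<^bsub>H\<^esub>, \<one>\<^bsub>\<Gamma>\<^esub>)}"
  proof -
    have "\<one>\<^bsub>\<Gamma>\<^esub> = s \<one>\<^bsub>Gal_CR\<^esub>" "\<one>\<^bsub>Gal_CR\<^esub> \<in> carrier Gal_CR"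
      using hom_one[OF s group_Gal_CR group_acting] group.is_monoid[OF group_Gal_CR]
      by (simp_all add: monoid.one_closed)
    then show ?thesis by (auto simp: kernel_semidirect)
  qed
  ultimately show ?thesis
    using assms by (simp add: group_semidirect comm_group_ker_semidirect)
qed

end

section \<open>Counting automorphisms and comparing triples\<close>

lemma class_triple_split:
  assumes "group \<Gamma>" "class_triple \<Gamma> s (G, c, \<pi>)"
  obtains \<iota> where "split_triple \<Gamma> s G c \<pi> \<iota>"
proof -
  interpret class_triple_context \<Gamma> s G c \<pi> by (rule class_triple_context.intro[OF assms])
  obtain \<iota> where "\<iota> \<in> hom \<Gamma> G" "\<And>g. g \<in> carrier \<Gamma> \<Longrightarrow> \<pi> (\<iota> g) = g"
    "\<And>\<sigma>. \<sigma> \<in> carrier Gal_CR \<Longrightarrow> \<iota> (s \<sigma>) = c \<sigma>"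
    using proj_splits_over_c by metis
  then have "split_triple \<Gamma> s G c \<pi> \<iota>" by unfold_locales
  then show ?thesis by (rule that)
qed

lemma card_triple_Aut:
  assumes "group \<Gamma>" "class_triple \<Gamma> s (G, c, \<pi>)"
  shows "card (triple_Aut (G, c, \<pi>)) =
    card (fixed_points (s ` carrier Gal_CR) (ker_group G \<Gamma> \<pi>) (conj_action G \<Gamma> \<pi>))
    * card (module_Aut \<Gamma> (ker_group G \<Gamma> \<pi>) (conj_action G \<Gamma> \<pi>))"
proof -
  obtain \<iota> where "split_triple \<Gamma> s G c \<pi> \<iota>"
    using class_triple_split[OF assms] by blast
  then interpret A: split_triple \<Gamma> s G c \<pi> \<iota> .
  \<comment> \<open>With the same split triple at both ends, the two parameter sets become the fixed
    points and the module automorphisms of the formula.\<close>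
  interpret split_triple_pair \<Gamma> s G c \<pi> \<iota> G c \<pi> \<iota> by unfold_locales
  have "module_Aut \<Gamma> (ker_group G \<Gamma> \<pi>) (conj_action G \<Gamma> \<pi>) = module_isos"
    by (simp add: module_Aut_def)
  then show ?thesis
    using bij_betw_same_card[OF triple_iso_param]
    by (simp only: triple_Aut_def card_cartesian_product)
qed

text \<open>By the parametrisation, one parameter pair suffices: \<open>k\<close> is the unit, and
  \<alpha> leads from the first kernel to \<open>H\<close> and back to the second kernel.\<close>

lemma class_triples_isomorphic:
  assumes \<Gamma>: "group \<Gamma>" and H: "group_module \<Gamma> H \<phi>"
    and T1: "class_triple \<Gamma> s (G1, c1, \<pi>1)" "kernel_isomorphic \<Gamma> (G1, c1, \<pi>1) H \<phi>"
    and T2: "class_triple \<Gamma> s (G2, c2, \<pi>2)" "kernel_isomorphic \<Gamma> (G2, c2, \<pi>2) H \<phi>"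
  shows "triple_isomorphic (G1, c1, \<pi>1) (G2, c2, \<pi>2)"
proof -
  obtain \<iota>1 \<iota>2 where "split_triple \<Gamma> s G1 c1 \<pi>1 \<iota>1" "split_triple \<Gamma> s G2 c2 \<pi>2 \<iota>2"
    using class_triple_split[OF \<Gamma> T1(1)] class_triple_split[OF \<Gamma> T2(1)] by metis
  then interpret split_triple_pair \<Gamma> s G1 c1 \<pi>1 \<iota>1 G2 c2 \<pi>2 \<iota>2
    by (rule split_triple_pair.intro)
  obtain f1 f2 where f1: "f1 \<in> module_iso \<Gamma> (ker_group G1 \<Gamma> \<pi>1) A.act H \<phi>"
    and f2: "f2 \<in> module_iso \<Gamma> (ker_group G2 \<Gamma> \<pi>2) B.act H \<phi>"
    using T1(2) T2(2) by auto
  have "compose A.K (inv_into (carrier (ker_group G2 \<Gamma> \<pi>2)) f2) f1 \<in> module_isos"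
    using module_iso_trans[OF A.M.group_module_axioms f1 module_iso_sym[OF B.M.group_module_axioms H f2]]
    by simp
  moreover have "\<one>\<^bsub>G2\<^esub> \<in> fixed_kernel"
    using B.c_closed by (simp add: fixed_kernel_iff)
  ultimately show ?thesis
    using triple_iso_param unfolding triple_isomorphic_def bij_betw_def by blast
qed

text \<open>As types cannot be quantified over inside the statement, existence is asserted on the
  type of pairs carrying the semidirect product, while uniqueness compares triples over two
  arbitrary types.\<close>

theorem theorem5p1:
  fixes \<Gamma> :: "'g monoid" and s :: "(complex \<Rightarrow> complex) \<Rightarrow> 'g"
  assumes "group \<Gamma>" and "finite (carrier \<Gamma>)" and "s \<in> hom Gal_CR \<Gamma>"
  shows "(\<forall>(G :: 'a monoid) c \<pi>. class_triple \<Gamma> s (G, c, \<pi>) \<longrightarrow>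
            card (triple_Aut (G, c, \<pi>)) =
              card (fixed_points (s ` carrier Gal_CR) (ker_group G \<Gamma> \<pi>) (conj_action G \<Gamma> \<pi>))
              * card (module_Aut \<Gamma> (ker_group G \<Gamma> \<pi>) (conj_action G \<Gamma> \<pi>))) \<and>
         (\<forall>(H :: 'h monoid) \<phi>.
            group_module \<Gamma> H \<phi> \<and> finite (carrier H) \<and> coprime (order H) (order \<Gamma>) \<and>
            fixed_points (carrier \<Gamma>) H \<phi> = {\<one>\<^bsub>H\<^esub>} \<longrightarrow>
              (\<exists>T :: ('h \<times> 'g, 'g) triple. class_triple \<Gamma> s T \<and> kernel_isomorphic \<Gamma> T H \<phi>) \<and>
              (\<forall>(T1 :: ('a, 'g) triple) (T2 :: ('b, 'g) triple).
                 class_triple \<Gamma> s T1 \<and> kernel_isomorphic \<Gamma> T1 H \<phi> \<and>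
                 class_triple \<Gamma> s T2 \<and> kernel_isomorphic \<Gamma> T2 H \<phi> \<longrightarrow>
                 triple_isomorphic T1 T2))"
proof (intro conjI allI impI; (elim conjE)?)
  fix G :: "'a monoid" and c \<pi>
  assume "class_triple \<Gamma> s (G, c, \<pi>)"
  then show "card (triple_Aut (G, c, \<pi>)) =
      card (fixed_points (s ` carrier Gal_CR) (ker_group G \<Gamma> \<pi>) (conj_action G \<Gamma> \<pi>))
      * card (module_Aut \<Gamma> (ker_group G \<Gamma> \<pi>) (conj_action G \<Gamma> \<pi>))"
    by (rule card_triple_Aut[OF assms(1)])
next
  fix H :: "'h monoid" and \<phi>
  assume H: "group_module \<Gamma> H \<phi>" "finite (carrier H)" "coprime (order H) (order \<Gamma>)"
    "fixed_points (carrier \<Gamma>) H \<phi> = {\<one>\<^bsub>H\<^esub>}"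
  have "class_triple \<Gamma> s (semidirect H \<Gamma> \<phi>, \<lambda>\<sigma>. (\<one>\<^bsub>H\<^esub>, s \<sigma>), snd)"
    by (rule group_module.class_triple_semidirect[OF H(1) assms(2,3) H(2-4)])
  moreover have "kernel_isomorphic \<Gamma> (semidirect H \<Gamma> \<phi>, \<lambda>\<sigma>. (\<one>\<^bsub>H\<^esub>, s \<sigma>), snd) H \<phi>"
    using group_module.fst_module_iso_semidirect[OF H(1)] by auto
  ultimately show "\<exists>T :: ('h \<times> 'g, 'g) triple. class_triple \<Gamma> s T \<and> kernel_isomorphic \<Gamma> T H \<phi>"
    by blast
next
  fix H :: "'h monoid" and \<phi> and T1 :: "('a, 'g) triple" and T2 :: "('b, 'g) triple"
  assume "group_module \<Gamma> H \<phi>"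
    "class_triple \<Gamma> s T1" "kernel_isomorphic \<Gamma> T1 H \<phi>"
    "class_triple \<Gamma> s T2" "kernel_isomorphic \<Gamma> T2 H \<phi>"
  then show "triple_isomorphic T1 T2"
    by (cases T1, cases T2) (simp only: class_triples_isomorphic[OF assms(1)])
qed

end
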